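(* Let $(X,\mathcal{B},\mu)$ be a Lebesgue space, let $T\colon X\to X$ be an invertible measure-preserving transformation, and let $f\in L^2(X,\mu)$. Then the following statements are equivalent: (1) $f$ is an almost periodic function in $L^2(X,\mu)$. (2) $f$ is $\mu$-mean equicontinuous. (3) $\mu$ has bounded complexity with respect to $\{\bar f_n\}$.
   Context: A Lebesgue space is a measure space $(X,\mathcal{B},\mu)$ where $(X,\mathcal{B})$ is a standard Borel space and $\mu$ is a regular probability measure on $\mathcal{B}$. Here $f$ is complex-valued and regarded as an everywhere-defined measurable representative of its class. $f$ is almost periodic if the closure of $\{f\circ T^n:n\in\mathbb{Z}\}$ is compact in $L^2(X,\mu)$. $f$ is $\mu$-mean equicontinuous if for any $\epsilon>0$ there are $k\in\mathbb{N}$ and measurable sets $A_1,\dots,A_k$ with $\mu\left(\bigcup_{i=1}^kA_i\right)>1-\epsilon$ such that if $x,y\in A_i$ for some $1\le i\le k$ then $\limsup_{n\to\infty}\frac1n\sum_{j=0}^{n-1}|f(T^jx)-f(T^jy)|<\epsilon$. For $x,y\in X$, $n\ge1$ and $\varepsilon>0$ put $\bar f_n(x,y)=\frac1n\sum_{i=0}^{n-1}|f(T^ix)-f(T^iy)|$, $B_{\bar f_n}(x,\varepsilon)=\{y\in X:\bar f_n(x,y)<\varepsilon\}$, and $K(n,\varepsilon,\bar f)=\min\{\#(F):F\subset X\text{ finite},\ \mu(\bigcup_{x\in F}B_{\bar f_n}(x,\varepsilon))>1-\varepsilon\}$, where $\#$ denotes the number of elements. $\mu$ has bounded complexity with respect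 to $\{\bar f_n\}$ if for every $\varepsilon>0$ there exists a positive integer $C=C(\varepsilon)$ such that $K(n,\varepsilon,\bar f)\le C$ for all $n\ge1$. *)

theory Defs
  imports "HOL-Analysis.Analysis" "HOL-Probability.Probability_Measure"
begin

section \<open>Lebesgue spaces and invertible measure-preserving maps\<close>

definition Polish_space :: "'a topology \<Rightarrow> bool" where
  "Polish_space S \<longleftrightarrow> completely_metrizable_space S \<and> second_countable S"

definition regular_measure :: "'a topology \<Rightarrow> 'a measure \<Rightarrow> bool" where
  "regular_measure S M \<longleftrightarrow>
     (\<forall>A\<in>sets M.
        emeasure M A = (INF U\<in>{U. openin S U \<and> A \<subseteq> U}. emeasure M U) \<and>
        emeasure M A = (SUP K\<in>{K. compactin S K \<and> K \<subseteq> A}. emeasure M K))"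

definition Lebesgue_space :: "'a measure \<Rightarrow> bool" where
  "Lebesgue_space M \<longleftrightarrow>
     prob_space M \<and>
     (\<exists>S. Polish_space S \<and> topspace S = space M \<and>
          sets M = sigma_sets (space M) {U. openin S U} \<and> regular_measure S M)"

definition invertible_mpt :: "'a measure \<Rightarrow> ('a \<Rightarrow> 'a) \<Rightarrow> bool" where
  "invertible_mpt M T \<longleftrightarrow>
     bij_betw T (space M) (space M) \<and>
     T \<in> measurable M M \<and> the_inv_into (space M) T \<in> measurable M M \<and>
     distr M M T = M"

definition int_iterate :: "'a measure \<Rightarrow> ('a \<Rightarrow> 'a) \<Rightarrow> int \<Rightarrow> 'a \<Rightarrow> 'a" where
  "int_iterate M T n =
     (if 0 \<le> n then T ^^ nat n else the_inv_into (space M) T ^^ nat (- n))"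

section \<open>The metric space \<open>L\<^sup>2\<close>\<close>

definition sq_integrable :: "'a measure \<Rightarrow> ('a \<Rightarrow> complex) \<Rightarrow> bool" where
  "sq_integrable M f \<longleftrightarrow> f \<in> borel_measurable M \<and> integrable M (\<lambda>x. (cmod (f x))\<^sup>2)"

definition L2_norm :: "'a measure \<Rightarrow> ('a \<Rightarrow> complex) \<Rightarrow> real" where
  "L2_norm M f = sqrt (\<integral>x. (cmod (f x))\<^sup>2 \<partial>M)"

definition ae_rel :: "'a measure \<Rightarrow> (('a \<Rightarrow> complex) \<times> ('a \<Rightarrow> complex)) set" where
  "ae_rel M = {(f, g). sq_integrable M f \<and> sq_integrable M g \<and> (AE x in M. f x = g x)}"

definition L2_space :: "'a measure \<Rightarrow> ('a \<Rightarrow> complex) set set" where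
  "L2_space M = {f. sq_integrable M f} // ae_rel M"

definition L2_class :: "'a measure \<Rightarrow> ('a \<Rightarrow> complex) \<Rightarrow> ('a \<Rightarrow> complex) set" where
  "L2_class M f = ae_rel M `` {f}"

text \<open>The distance does not depend on the chosen representatives; see \<open>L2_dist_class\<close> below.\<close>

definition L2_dist :: "'a measure \<Rightarrow> ('a \<Rightarrow> complex) set \<Rightarrow> ('a \<Rightarrow> complex) set \<Rightarrow> real" where
  "L2_dist M A B = L2_norm M (\<lambda>x. (SOME f. f \<in> A) x - (SOME g. g \<in> B) x)"

definition L2_topology :: "'a measure \<Rightarrow> ('a \<Rightarrow> complex) set topology" where
  "L2_topology M = Metric_space.mtopology (L2_space M) (L2_dist M)"

lemma equiv_ae_rel: "equiv {f. sq_integrable M f} (ae_rel M)"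
proof (rule equivI)
  show "trans (ae_rel M)"
  proof (rule transI)
    fix f g h assume "(f, g) \<in> ae_rel M" "(g, h) \<in> ae_rel M"
    then have "sq_integrable M f" "sq_integrable M h"
      and "AE x in M. f x = g x" "AE x in M. g x = h x"
      by (auto simp: ae_rel_def)
    moreover from this(3,4) have "AE x in M. f x = h x" by eventually_elim simp
    ultimately show "(f, h) \<in> ae_rel M" by (simp add: ae_rel_def)
  qed
  show "sym (ae_rel M)"
    by (rule symI) (simp add: ae_rel_def eq_commute)
qed (auto simp: ae_rel_def refl_on_def)

lemma sq_integrable_mult:
  assumes "sq_integrable M f" "sq_integrable M g"
  shows "integrable M (\<lambda>x. cmod (f x) * cmod (g x))"
proof (rule Bochner_Integration.integrable_bound)
  show "integrable M (\<lambda>x. (cmod (f x))\<^sup>2 + (cmod (g x))\<^sup>2)"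
    using assms by (auto simp: sq_integrable_def)
  show "(\<lambda>x. cmod (f x) * cmod (g x)) \<in> borel_measurable M"
    using assms by (auto simp: sq_integrable_def)
  have "a * b \<le> a\<^sup>2 + b\<^sup>2" if "0 \<le> a" "0 \<le> b" for a b :: real
    using sum_squares_bound[of a b] mult_nonneg_nonneg[OF that] by linarith
  then show "AE x in M. norm (cmod (f x) * cmod (g x)) \<le> norm ((cmod (f x))\<^sup>2 + (cmod (g x))\<^sup>2)"
    by (auto simp: abs_mult)
qed

lemma sq_integrable_add:
  assumes "sq_integrable M f" "sq_integrable M g"
  shows "sq_integrable M (\<lambda>x. f x + g x)"
  unfolding sq_integrable_def
proof
  show m: "(\<lambda>x. f x + g x) \<in> borel_measurable M"
    using assms by (auto simp: sq_integrable_def)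
  show "integrable M (\<lambda>x. (cmod (f x + g x))\<^sup>2)"
  proof (rule Bochner_Integration.integrable_bound)
    show "integrable M (\<lambda>x. (cmod (f x))\<^sup>2 + (cmod (g x))\<^sup>2 + 2 * (cmod (f x) * cmod (g x)))"
      using assms sq_integrable_mult[OF assms] by (auto simp: sq_integrable_def)
    have "(cmod (f x + g x))\<^sup>2 \<le> (cmod (f x))\<^sup>2 + (cmod (g x))\<^sup>2 + 2 * (cmod (f x) * cmod (g x))" for x
      using power_mono[OF norm_triangle_ineq[of "f x" "g x"], of 2] by (simp add: power2_sum)
    then show "AE x in M. norm ((cmod (f x + g x))\<^sup>2) \<le>
        norm ((cmod (f x))\<^sup>2 + (cmod (g x))\<^sup>2 + 2 * (cmod (f x) * cmod (g x)))"
      by (intro AE_I2) simp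
    show "(\<lambda>x. (cmod (f x + g x))\<^sup>2) \<in> borel_measurable M"
      by (intro borel_measurable_power measurable_compose[OF m borel_measurable_norm])
  qed
qed

lemma sq_integrable_diff:
  assumes "sq_integrable M f" "sq_integrable M g"
  shows "sq_integrable M (\<lambda>x. f x - g x)"
proof -
  have "sq_integrable M (\<lambda>x. - g x)" using assms by (auto simp: sq_integrable_def)
  from sq_integrable_add[OF assms(1) this] show ?thesis by simp
qed

lemma L2_norm_nonneg: "0 \<le> L2_norm M f"
  by (simp add: L2_norm_def)

lemma L2_norm_triangle:
  assumes f: "sq_integrable M f" and g: "sq_integrable M g"
  shows "L2_norm M (\<lambda>x. f x + g x) \<le> L2_norm M f + L2_norm M g"
proof -
  define a where "a = (\<integral>x. (cmod (f x))\<^sup>2 \<partial>M)"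
  define b where "b = (\<integral>x. (cmod (g x))\<^sup>2 \<partial>M)"
  define c where "c = (\<integral>x. cmod (f x) * cmod (g x) \<partial>M)"
  have ab: "0 \<le> a" "0 \<le> b" "0 \<le> c" by (auto simp: a_def b_def c_def)
  have mf [measurable]: "f \<in> borel_measurable M" "g \<in> borel_measurable M"
    using f g by (auto simp: sq_integrable_def)
  have "(\<integral>\<^sup>+x. ennreal (cmod (f x)) * ennreal (cmod (g x)) \<partial>M)\<^sup>2
      \<le> (\<integral>\<^sup>+x. (ennreal (cmod (f x)))\<^sup>2 \<partial>M) * (\<integral>\<^sup>+x. (ennreal (cmod (g x)))\<^sup>2 \<partial>M)"
    by (rule Cauchy_Schwarz_nn_integral) auto
  moreover have "(\<integral>\<^sup>+x. ennreal (cmod (f x)) * ennreal (cmod (g x)) \<partial>M) = ennreal c"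
    using sq_integrable_mult[OF f g]
    by (simp add: c_def nn_integral_eq_integral flip: ennreal_mult)
  moreover have "(\<integral>\<^sup>+x. (ennreal (cmod (f x)))\<^sup>2 \<partial>M) = ennreal a"
    using f by (simp add: a_def nn_integral_eq_integral sq_integrable_def ennreal_power)
  moreover have "(\<integral>\<^sup>+x. (ennreal (cmod (g x)))\<^sup>2 \<partial>M) = ennreal b"
    using g by (simp add: b_def nn_integral_eq_integral sq_integrable_def ennreal_power)
  ultimately have "c\<^sup>2 \<le> a * b"
    using ab by (simp add: ennreal_power flip: ennreal_mult)
  then have c: "c \<le> sqrt a * sqrt b"
    by (metis real_le_rsqrt real_sqrt_mult)
  have "(\<integral>x. (cmod (f x + g x))\<^sup>2 \<partial>M)
      \<le> (\<integral>x. (cmod (f x))\<^sup>2 + (cmod (g x))\<^sup>2 + 2 * (cmod (f x) * cmod (g x)) \<partial>M)"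
  proof (rule integral_mono)
    show "integrable M (\<lambda>x. (cmod (f x + g x))\<^sup>2)"
      using sq_integrable_add[OF f g] by (simp add: sq_integrable_def)
    show "integrable M (\<lambda>x. (cmod (f x))\<^sup>2 + (cmod (g x))\<^sup>2 + 2 * (cmod (f x) * cmod (g x)))"
      using f g sq_integrable_mult[OF f g] by (auto simp: sq_integrable_def)
    show "(cmod (f x + g x))\<^sup>2 \<le> (cmod (f x))\<^sup>2 + (cmod (g x))\<^sup>2 + 2 * (cmod (f x) * cmod (g x))" for x
      using power_mono[OF norm_triangle_ineq[of "f x" "g x"], of 2] by (simp add: power2_sum)
  qed
  also have "\<dots> = a + b + 2 * c"
    using f g sq_integrable_mult[OF f g] by (simp add: sq_integrable_def a_def b_def c_def)
  also have "\<dots> \<le> (sqrt a + sqrt b)\<^sup>2"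
    using ab c by (simp add: power2_sum)
  finally show ?thesis
    using ab by (simp add: L2_norm_def real_le_lsqrt flip: a_def b_def)
qed

lemma L2_norm_cong_AE:
  assumes "f \<in> borel_measurable M" "g \<in> borel_measurable M" "AE x in M. f x = g x"
  shows "L2_norm M f = L2_norm M g"
proof -
  have "(\<integral>x. (cmod (f x))\<^sup>2 \<partial>M) = (\<integral>x. (cmod (g x))\<^sup>2 \<partial>M)"
    using assms by (intro integral_cong_AE) auto
  then show ?thesis by (simp add: L2_norm_def)
qed

lemma L2_norm_eq_0_iff:
  assumes "sq_integrable M f"
  shows "L2_norm M f = 0 \<longleftrightarrow> (AE x in M. f x = 0)"
  using assms by (simp add: L2_norm_def sq_integrable_def integral_nonneg_eq_0_iff_AE)

lemma L2_class_in_space: "sq_integrable M f \<Longrightarrow> L2_class M f \<in> L2_space M"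
  by (auto simp: L2_class_def L2_space_def intro: quotientI)

lemma L2_spaceE:
  assumes "A \<in> L2_space M"
  obtains f where "sq_integrable M f" "A = L2_class M f"
  using assms by (auto simp: L2_class_def L2_space_def elim: quotientE)

lemma L2_class_eq_iff:
  "sq_integrable M f \<Longrightarrow> sq_integrable M g \<Longrightarrow>
     L2_class M f = L2_class M g \<longleftrightarrow> (AE x in M. f x = g x)"
  unfolding L2_class_def
  by (subst eq_equiv_class_iff[OF equiv_ae_rel]) (auto simp: ae_rel_def)

lemma L2_dist_class:
  assumes f: "sq_integrable M f" and g: "sq_integrable M g"
  shows "L2_dist M (L2_class M f) (L2_class M g) = L2_norm M (\<lambda>x. f x - g x)"
proof -
  have some: "(f, SOME h. h \<in> L2_class M f) \<in> ae_rel M" if "sq_integrable M f" for f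
  proof -
    have "f \<in> L2_class M f" using that by (auto simp: L2_class_def ae_rel_def)
    then have "(SOME h. h \<in> L2_class M f) \<in> L2_class M f" by (rule someI[where P = "\<lambda>h. h \<in> L2_class M f"])
    then show ?thesis by (simp add: L2_class_def)
  qed
  show ?thesis
    unfolding L2_dist_def
  proof (rule L2_norm_cong_AE)
    let ?f = "SOME h. h \<in> L2_class M f" and ?g = "SOME h. h \<in> L2_class M g"
    have [measurable]: "f \<in> borel_measurable M" "g \<in> borel_measurable M"
      "?f \<in> borel_measurable M" "?g \<in> borel_measurable M"
      using some[OF f] some[OF g] by (simp_all add: ae_rel_def sq_integrable_def)
    show "(\<lambda>x. ?f x - ?g x) \<in> borel_measurable M" "(\<lambda>x. f x - g x) \<in> borel_measurable M"
      by measurable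
    have "AE x in M. f x = ?f x" "AE x in M. g x = ?g x"
      using some[OF f] some[OF g] by (simp_all add: ae_rel_def)
    then show "AE x in M. ?f x - ?g x = f x - g x" by eventually_elim simp
  qed
qed

lemma Metric_space_L2: "Metric_space (L2_space M) (L2_dist M)"
proof
  show "0 \<le> L2_dist M A B" for A B
    by (simp add: L2_dist_def L2_norm_nonneg)
  show "L2_dist M A B = L2_dist M B A" for A B
    by (simp add: L2_dist_def L2_norm_def norm_minus_commute)
  show "L2_dist M A B = 0 \<longleftrightarrow> A = B" if "A \<in> L2_space M" "B \<in> L2_space M" for A B
  proof -
    from that obtain f g where
      "sq_integrable M f" "A = L2_class M f" "sq_integrable M g" "B = L2_class M g"
      by (metis L2_spaceE)
    then show ?thesis
      by (simp add: L2_dist_class L2_class_eq_iff L2_norm_eq_0_iff sq_integrable_diff)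
  qed
  show "L2_dist M A C \<le> L2_dist M A B + L2_dist M B C"
    if "A \<in> L2_space M" "B \<in> L2_space M" "C \<in> L2_space M" for A B C
  proof -
    from that obtain f g h where
      "sq_integrable M f" "A = L2_class M f" "sq_integrable M g" "B = L2_class M g"
      "sq_integrable M h" "C = L2_class M h"
      by (metis L2_spaceE)
    then show ?thesis
      using L2_norm_triangle[of M "\<lambda>x. f x - g x" "\<lambda>x. g x - h x"]
      by (simp add: L2_dist_class sq_integrable_diff)
  qed
qed

section \<open>The three properties\<close>

definition almost_periodic :: "'a measure \<Rightarrow> ('a \<Rightarrow> 'a) \<Rightarrow> ('a \<Rightarrow> complex) \<Rightarrow> bool" where
  "almost_periodic M T f \<longleftrightarrow>
     compactin (L2_topology M)
       (L2_topology M closure_of (range (\<lambda>n::int. L2_class M (f \<circ> int_iterate M T n))))"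

definition fbar :: "('a \<Rightarrow> 'a) \<Rightarrow> ('a \<Rightarrow> complex) \<Rightarrow> nat \<Rightarrow> 'a \<Rightarrow> 'a \<Rightarrow> real" where
  "fbar T f n x y = (1 / real n) * (\<Sum>i<n. cmod (f ((T ^^ i) x) - f ((T ^^ i) y)))"

text \<open>The upper limit is taken in \<^typ>\<open>ereal\<close>, since the averages may be unbounded.\<close>

definition mean_equicontinuous :: "'a measure \<Rightarrow> ('a \<Rightarrow> 'a) \<Rightarrow> ('a \<Rightarrow> complex) \<Rightarrow> bool" where
  "mean_equicontinuous M T f \<longleftrightarrow>
     (\<forall>\<epsilon>>0. \<exists>(k::nat) A.
        (\<forall>i\<in>{1..k}. A i \<in> sets M) \<and>
        measure M (\<Union>i\<in>{1..k}. A i) > 1 - \<epsilon> \<and>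
        (\<forall>i\<in>{1..k}. \<forall>x\<in>A i. \<forall>y\<in>A i. limsup (\<lambda>n. ereal (fbar T f n x y)) < ereal \<epsilon>))"

definition fbar_ball ::
    "'a measure \<Rightarrow> ('a \<Rightarrow> 'a) \<Rightarrow> ('a \<Rightarrow> complex) \<Rightarrow> nat \<Rightarrow> 'a \<Rightarrow> real \<Rightarrow> 'a set" where
  "fbar_ball M T f n x \<epsilon> = {y \<in> space M. fbar T f n x y < \<epsilon>}"

text \<open>With values in \<^typ>\<open>enat\<close>, an empty family of covers would give \<open>\<infinity>\<close>;
  for a nonempty family the infimum is attained.\<close>

definition covering_number ::
    "'a measure \<Rightarrow> ('a \<Rightarrow> 'a) \<Rightarrow> ('a \<Rightarrow> complex) \<Rightarrow> nat \<Rightarrow> real \<Rightarrow> enat" where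
  "covering_number M T f n \<epsilon> =
     (INF F\<in>{F. finite F \<and> F \<subseteq> space M \<and>
                measure M (\<Union>x\<in>F. fbar_ball M T f n x \<epsilon>) > 1 - \<epsilon>}. enat (card F))"

definition bounded_complexity :: "'a measure \<Rightarrow> ('a \<Rightarrow> 'a) \<Rightarrow> ('a \<Rightarrow> complex) \<Rightarrow> bool" where
  "bounded_complexity M T f \<longleftrightarrow>
     (\<forall>\<epsilon>>0. \<exists>C::nat. 0 < C \<and> (\<forall>n\<ge>1. covering_number M T f n \<epsilon> \<le> enat C))"

end

theory Submission
  imports Defs
begin

text \<open>
  Write \<open>d i j = \<parallel>f \<circ> T\<^sup>i - f \<circ> T\<^sup>j\<parallel>\<close> in \<open>L\<^sup>2\<close>; it depends only on \<open>i - j\<close>, and by completeness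
  of \<open>L\<^sup>2\<close> almost periodicity means that the orbit of \<open>f\<close> is totally bounded.

  From (1) to (2): take finitely many times \<open>J\<close> such that every \<open>f \<circ> T\<^sup>n\<close> is close to some
  \<open>f \<circ> T\<^sup>s\<close> with \<open>s \<in> J\<close>, and a countable partition into cells on which all these \<open>f \<circ> T\<^sup>s\<close> are nearly
  constant. For independent random points \<open>x, y\<close> of a common cell the expectation of
  \<open>\<bar>f (T\<^sup>n x) - f (T\<^sup>n y)\<bar>\<close> is small uniformly in \<open>n\<close>. Birkhoff's theorem for \<open>T \<times> T\<close> and Fatou's
  lemma carry this over to the upper limit of the averages, and in each cell one fixes a typical
  centre \<open>x\<close>.

  From (2) to (3): for large \<open>n\<close> one centre per set \<open>A\<^sub>i\<close> suffices, by continuity of the measure.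

  From (3) to (1): for a bounded truncation of \<open>f\<close> and each \<open>n\<close>, boundedly many centres give an
  approximation of most \<open>f \<circ> T\<^sup>i\<close>, \<open>i < n\<close>, by functions taking boundedly many values; by
  pigeonhole a proportion \<open>1/K\<close> of all \<open>i < n\<close> are mutually close, with \<open>K\<close> independent of \<open>n\<close>.
  By translation invariance of \<open>d\<close>, a separated set of integers has then at most \<open>K\<close> elements.
\<close>

section \<open>Measure-preserving maps; used below for \<open>T\<close>, for its inverse and for
  \<open>map_prod T T\<close>\<close>

locale mpt = prob_space M for M :: "'a measure" +
  fixes T :: "'a \<Rightarrow> 'a"
  assumes T_measurable [measurable]: "T \<in> measurable M M"
    and T_distr: "distr M M T = M"
begin

lemma funpow_measurable [measurable]: "T ^^ n \<in> measurable M M"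
  by (rule measurable_compose_n[OF T_measurable])

lemma funpow_distr: "distr M M (T ^^ n) = M"
proof (induction n)
  case 0
  show ?case by (simp add: distr_id2 id_def)
next
  case (Suc n)
  have "distr M M (T ^^ Suc n) = distr (distr M M (T ^^ n)) M T"
    by (subst distr_distr) auto
  also have "\<dots> = M" unfolding Suc by (rule T_distr)
  finally show ?case .
qed

lemma integral_funpow:
  fixes g :: "'a \<Rightarrow> 'b :: {banach, second_countable_topology}"
  assumes "g \<in> borel_measurable M"
  shows "(\<integral>x. g ((T ^^ n) x) \<partial>M) = (\<integral>x. g x \<partial>M)"
  by (subst (2) funpow_distr[symmetric, of n], subst integral_distr) (use assms in auto)

lemma integrable_funpow:
  fixes g :: "'a \<Rightarrow> 'b :: {banach, second_countable_topology}"
  assumes "integrable M g"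
  shows "integrable M (\<lambda>x. g ((T ^^ n) x))"
  using integrable_distr[of "T ^^ n" M M g] assms by (simp add: funpow_distr)

lemmas integral_T = integral_funpow[where n = 1, simplified]
lemmas integrable_T = integrable_funpow[where n = 1, simplified]

end

section \<open>Birkhoff averages\<close>

text \<open>The maximum over \<open>k \<le> n\<close> of the partial sums
  \<open>\<Sum>i<k. g ((T ^^ i) x)\<close>. The recursion splits off the first term, which is the
  identity behind the maximal inequality.\<close>

primrec max_sum :: "('a \<Rightarrow> 'a) \<Rightarrow> ('a \<Rightarrow> real) \<Rightarrow> nat \<Rightarrow> 'a \<Rightarrow> real" where
  "max_sum T g 0 x = 0"
| "max_sum T g (Suc n) x = max 0 (g x + max_sum T g n (T x))"

lemma max_sum_nonneg: "0 \<le> max_sum T g n x"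
  by (cases n) auto

lemma max_sum_mono: "max_sum T g n x \<le> max_sum T g (Suc n) x"
proof (induction n arbitrary: x)
  case (Suc n)
  from Suc[of "T x"] show ?case by auto
qed auto

lemma sum_le_max_sum: "(\<Sum>i<n. g ((T ^^ i) x)) \<le> max_sum T g n x"
proof (induction n arbitrary: x)
  case (Suc n)
  have "(\<Sum>i<Suc n. g ((T ^^ i) x)) = g x + (\<Sum>i<n. g ((T ^^ i) (T x)))"
    by (simp add: sum.lessThan_Suc_shift funpow_swap1 del: sum.lessThan_Suc)
  with Suc[of "T x"] show ?case by simp
qed auto

context mpt
begin

lemma integrable_max_sum:
  assumes "integrable M g"
  shows "integrable M (max_sum T g n)"
proof (induction n)
  case (Suc n)
  have "integrable M (\<lambda>x. max 0 (g x + max_sum T g n (T x)))"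
    using assms integrable_T[OF Suc] by (intro integrable_max) auto
  then show ?case by (simp add: fun_eq_iff cong: integrable_cong)
qed (simp add: fun_eq_iff)

text \<open>Garsia's argument. Where \<open>?m n\<close> is positive it is at most
  \<open>g x + ?m n (T x)\<close>, so \<open>?m n x - ?m n (T x)\<close> is bounded by
  \<open>g\<close> cut off to that set; the left side has integral 0 by invariance. As
  \<open>n\<close> grows, the sets exhaust all points with \<open>g x \<noteq> 0\<close>, and
  dominated convergence removes the cutoff.\<close>

lemma maximal_ergodic:
  fixes g :: "'a \<Rightarrow> real"
  assumes g: "integrable M g"
    and pos: "\<And>x. x \<in> space M \<Longrightarrow> g x = 0 \<or> (\<exists>n. 0 < (\<Sum>i<n. g ((T ^^ i) x)))"
  shows "0 \<le> (\<integral>x. g x \<partial>M)"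
proof -
  let ?m = "max_sum T g"
  have gm [measurable]: "g \<in> borel_measurable M" using g by auto
  have mm [measurable]: "?m n \<in> borel_measurable M" for n
    using integrable_max_sum[OF g, of n] by auto
  have "0 \<le> (\<integral>x. indicator {x \<in> space M. 0 < ?m n x} x * g x \<partial>M)" for n
  proof -
    have "0 = (\<integral>x. ?m n x - ?m n (T x) \<partial>M)"
      using integrable_max_sum[OF g, of n] integrable_T[OF integrable_max_sum[OF g, of n]]
      by (simp add: integral_T)
    also have "\<dots> \<le> (\<integral>x. indicator {x \<in> space M. 0 < ?m n x} x * g x \<partial>M)"
    proof (rule integral_mono)
      show "integrable M (\<lambda>x. ?m n x - ?m n (T x))"
        using integrable_max_sum[OF g, of n] integrable_T[OF integrable_max_sum[OF g, of n]] by simp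
      show "integrable M (\<lambda>x. indicator {x \<in> space M. 0 < ?m n x} x * g x)"
        by (subst mult.commute, rule integrable_real_mult_indicator[OF _ g]) measurable
      fix x assume x: "x \<in> space M"
      show "?m n x - ?m n (T x) \<le> indicator {x \<in> space M. 0 < ?m n x} x * g x"
      proof (cases "0 < ?m n x")
        case True
        then obtain k where k: "n = Suc k" by (cases n) auto
        with True have "?m n x = g x + ?m k (T x)" by auto
        with max_sum_mono[of T g k "T x"] k show ?thesis using x True by simp
      next
        case False
        then show ?thesis using max_sum_nonneg[of T g n x] max_sum_nonneg[of T g n "T x"] by simp
      qed
    qed
    finally show ?thesis .
  qed
  moreover have "(\<lambda>n. \<integral>x. indicator {x \<in> space M. 0 < ?m n x} x * g x \<partial>M)
      \<longlonglongrightarrow> (\<integral>x. g x \<partial>M)"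
  proof (rule integral_dominated_convergence[where w = "\<lambda>x. \<bar>g x\<bar>"])
    show "integrable M (\<lambda>x. \<bar>g x\<bar>)" using g by simp
    show "AE x in M. (\<lambda>n. indicator {x \<in> space M. 0 < ?m n x} x * g x) \<longlonglongrightarrow> g x"
    proof (rule AE_I2)
      fix x assume x: "x \<in> space M"
      show "(\<lambda>n. indicator {x \<in> space M. 0 < ?m n x} x * g x) \<longlonglongrightarrow> g x"
      proof (cases "g x = 0")
        case False
        with pos[OF x] obtain n where "0 < (\<Sum>i<n. g ((T ^^ i) x))" by auto
        then have n: "0 < ?m n x" using sum_le_max_sum[of g T x n] by linarith
        have "incseq (\<lambda>n. ?m n x)" by (rule incseq_SucI) (rule max_sum_mono)
        then have "0 < ?m k x" if "n \<le> k" for k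
          using n that by (meson incseqD less_le_trans)
        then have "eventually (\<lambda>k. indicator {x \<in> space M. 0 < ?m k x} x * g x = g x) sequentially"
          using x by (auto simp: eventually_sequentially intro!: exI[of _ n])
        then show ?thesis by (rule tendsto_eventually)
      qed simp
    qed
  qed (auto simp: indicator_def)
  ultimately show ?thesis by (meson LIMSEQ_le_const)
qed

text \<open>Apply \<open>maximal_ergodic\<close> to \<open>g\<close> multiplied by the indicator of
  \<open>B\<close>: by invariance its orbit sums agree with those of \<open>g\<close> on
  \<open>B\<close> and vanish elsewhere.\<close>

lemma maximal_ergodic_invariant:
  fixes g :: "'a \<Rightarrow> real"
  assumes g: "integrable M g" and B [measurable]: "B \<in> sets M"
    and inv: "\<And>x. x \<in> space M \<Longrightarrow> T x \<in> B \<longleftrightarrow> x \<in> B"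
    and pos: "\<And>x. x \<in> B \<Longrightarrow> \<exists>n. 0 < (\<Sum>i<n. g ((T ^^ i) x))"
  shows "0 \<le> (\<integral>x. indicator B x * g x \<partial>M)"
proof (rule maximal_ergodic)
  show "integrable M (\<lambda>x. indicator B x * g x)"
    by (subst mult.commute, rule integrable_real_mult_indicator[OF _ g]) measurable
  fix x assume x: "x \<in> space M"
  have "(T ^^ i) x \<in> space M \<and> ((T ^^ i) x \<in> B \<longleftrightarrow> x \<in> B)" for i
    by (induction i) (use x inv measurable_space[OF T_measurable] in auto)
  then have "(\<Sum>i<n. indicator B ((T ^^ i) x) * g ((T ^^ i) x))
      = indicator B x * (\<Sum>i<n. g ((T ^^ i) x))" for n
    by (simp add: sum_distrib_left indicator_def)
  then show "indicator B x * g x = 0 \<or>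
      (\<exists>n. 0 < (\<Sum>i<n. indicator B ((T ^^ i) x) * g ((T ^^ i) x)))"
    using pos[of x] by (auto simp: indicator_def)
qed

definition average :: "('a \<Rightarrow> real) \<Rightarrow> nat \<Rightarrow> 'a \<Rightarrow> real" where
  "average g n x = (\<Sum>i<n. g ((T ^^ i) x)) / real n"

lemma average_measurable [measurable]:
  assumes [measurable]: "g \<in> borel_measurable M"
  shows "average g n \<in> borel_measurable M"
  unfolding average_def[abs_def] by measurable

lemma average_T:
  assumes "0 < n"
  shows "average g n (T x) = (real (Suc n) / real n) * average g (Suc n) x - g x / real n"
proof -
  have "(\<Sum>i<Suc n. g ((T ^^ i) x)) = g x + (\<Sum>i<n. g ((T ^^ i) (T x)))"
    by (simp add: sum.lessThan_Suc_shift funpow_swap1 del: sum.lessThan_Suc)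
  then show ?thesis
    using assms by (simp add: average_def diff_divide_distrib[symmetric] del: sum.lessThan_Suc)
qed

text \<open>Averages at \<open>T x\<close> and at \<open>x\<close> differ by the factor
  \<open>(n + 1) / n\<close> and the term \<open>g x / n\<close>, which tend to 1 and 0. This makes
  the sets \<open>E a b\<close> in Birkhoff's theorem invariant.\<close>

lemma limsup_average_T:
  "limsup (\<lambda>n. ereal (average g n (T x))) = limsup (\<lambda>n. ereal (average g n x))"
  "liminf (\<lambda>n. ereal (average g n (T x))) = liminf (\<lambda>n. ereal (average g n x))"
proof -
  let ?u = "\<lambda>n. ereal (- g x / real n)" and ?c = "\<lambda>n. ereal (real (Suc n) / real n)"
  let ?a = "\<lambda>n. ereal (average g (Suc n) x)"
  have ev: "eventually (\<lambda>n. ereal (average g n (T x)) = ?u n + ?c n * ?a n) sequentially"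
    using eventually_gt_at_top[of 0] by eventually_elim (simp add: average_T)
  have c: "?c \<longlonglongrightarrow> 1"
    using LIMSEQ_Suc_n_over_n by (simp add: one_ereal_def)
  have u: "?u \<longlonglongrightarrow> 0"
    using lim_const_over_n[of "- g x"] by (simp add: zero_ereal_def)
  have s: "limsup ?a = limsup (\<lambda>n. ereal (average g n x))" "liminf ?a = liminf (\<lambda>n. ereal (average g n x))"
    using limsup_shift[of "\<lambda>n. ereal (average g n x)"] liminf_shift[of "\<lambda>n. ereal (average g n x)"]
    by simp_all
  show "limsup (\<lambda>n. ereal (average g n (T x))) = limsup (\<lambda>n. ereal (average g n x))"
    by (subst Limsup_eq[OF ev], subst ereal_limsup_lim_add[OF u], simp,
        subst ereal_limsup_lim_mult[OF c]) (simp_all add: s)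
  show "liminf (\<lambda>n. ereal (average g n (T x))) = liminf (\<lambda>n. ereal (average g n x))"
    by (subst Liminf_eq[OF ev], subst ereal_liminf_lim_add[OF u], simp,
        subst ereal_liminf_lim_mult[OF c]) (simp_all add: s)
qed

text \<open>For \<open>a < b\<close> let \<open>E a b\<close> be the invariant set where the lower
  limit is below \<open>a\<close> and the upper limit above \<open>b\<close>. The maximal inequality
  for \<open>g - b\<close> and for \<open>a - g\<close> on this set gives
  \<open>b * measure M (E a b) \<le> a * measure M (E a b)\<close>, so it is null. Rational
  \<open>a\<close> and \<open>b\<close> catch every point of divergence.\<close>

theorem birkhoff:
  assumes g: "integrable M g"
  shows "AE x in M. limsup (\<lambda>n. ereal (average g n x)) \<le> liminf (\<lambda>n. ereal (average g n x))"
proof -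
  have gm [measurable]: "g \<in> borel_measurable M" using g by auto
  define U where "U x = limsup (\<lambda>n. ereal (average g n x))" for x
  define L where "L x = liminf (\<lambda>n. ereal (average g n x))" for x
  have [measurable]: "U \<in> borel_measurable M" "L \<in> borel_measurable M"
    unfolding U_def[abs_def] L_def[abs_def] by measurable
  define E where "E a b = {x \<in> space M. L x < ereal a \<and> ereal b < U x}" for a b
  have E [measurable]: "E a b \<in> sets M" for a b unfolding E_def by measurable
  have inv: "T x \<in> E a b \<longleftrightarrow> x \<in> E a b" if "x \<in> space M" for x a b
    using that measurable_space[OF T_measurable that]
    by (simp add: E_def U_def L_def limsup_average_T)
  have null: "AE x in M. x \<notin> E a b" if "a < b" for a b
  proof -
    have i: "integrable M (\<lambda>x. indicator (E a b) x * g x)"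
      by (subst mult.commute, rule integrable_real_mult_indicator[OF _ g]) measurable
    have eq: "(\<integral>x. indicator (E a b) x * (g x - c) \<partial>M)
        = (\<integral>x. indicator (E a b) x * g x \<partial>M) - c * measure M (E a b)" for c
    proof -
      have "(\<integral>x. indicator (E a b) x * (g x - c) \<partial>M)
          = (\<integral>x. indicator (E a b) x * g x - c * indicator (E a b) x \<partial>M)"
        by (simp add: algebra_simps)
      also have "\<dots> = (\<integral>x. indicator (E a b) x * g x \<partial>M) - (\<integral>x. c * indicator (E a b) x \<partial>M)"
        using i by (intro Bochner_Integration.integral_diff) (auto simp: integrable_indicator_iff emeasure_eq_measure)
      finally show ?thesis by simp
    qed
    have "0 \<le> (\<integral>x. indicator (E a b) x * (g x - b) \<partial>M)"
    proof (rule maximal_ergodic_invariant)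
      fix x assume "x \<in> E a b"
      then have "ereal b < limsup (\<lambda>n. ereal (average g n x))" by (simp add: E_def U_def)
      \<comment> \<open>The case \<open>n = 0\<close> must be excluded: \<open>average g 0 x\<close>
        is 0 through division by zero and carries no information on the sums.\<close>
      then obtain n where n: "0 < n" "b < average g n x"
        using Limsup_bounded[OF eventually_mono[OF eventually_gt_at_top[of "0::nat"]],
            of "\<lambda>n. ereal (average g n x)" "ereal b"]
        by (meson ereal_less_eq(3) linorder_not_le)
      then show "\<exists>n. 0 < (\<Sum>i<n. g ((T ^^ i) x) - b)"
        by (intro exI[of _ n]) (simp add: average_def sum_subtractf field_simps)
    qed (use g inv in auto)
    moreover have "0 \<le> (\<integral>x. indicator (E a b) x * (a - g x) \<partial>M)"
    proof (rule maximal_ergodic_invariant)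
      fix x assume "x \<in> E a b"
      then have "liminf (\<lambda>n. ereal (average g n x)) < ereal a" by (simp add: E_def L_def)
      then obtain n where n: "0 < n" "average g n x < a"
        using Liminf_bounded[OF eventually_mono[OF eventually_gt_at_top[of "0::nat"]],
            of "ereal a" "\<lambda>n. ereal (average g n x)"]
        by (meson ereal_less_eq(3) linorder_not_le)
      then show "\<exists>n. 0 < (\<Sum>i<n. a - g ((T ^^ i) x))"
        by (intro exI[of _ n]) (simp add: average_def sum_subtractf field_simps)
    qed (use g inv in auto)
    moreover have "(\<integral>x. indicator (E a b) x * (a - g x) \<partial>M) = - (\<integral>x. indicator (E a b) x * (g x - a) \<partial>M)"
      by (subst integral_minus[symmetric], rule Bochner_Integration.integral_cong) (auto simp: algebra_simps)
    ultimately have "b * measure M (E a b) \<le> a * measure M (E a b)"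
      unfolding eq by linarith
    with that have "measure M (E a b) = 0"
      by (metis linorder_not_le measure_nonneg mult_le_cancel_right order_le_less)
    then show ?thesis
      by (intro AE_not_in) (simp add: null_sets_def emeasure_eq_measure)
  qed
  have "AE x in M. \<forall>a b::rat. a < b \<longrightarrow> x \<notin> E (real_of_rat a) (real_of_rat b)"
    by (simp add: AE_all_countable) (intro allI impI null, simp add: of_rat_less)
  from this AE_space show ?thesis
  proof eventually_elim
    case (elim x)
    show ?case
    proof (rule ccontr)
      assume "\<not> limsup (\<lambda>n. ereal (average g n x)) \<le> liminf (\<lambda>n. ereal (average g n x))"
      then have "L x < U x" by (simp add: U_def L_def)
      then obtain b where b: "L x < ereal (real_of_rat b)" "ereal (real_of_rat b) < U x"
        using ereal_dense3 by blast
      then obtain a where a: "L x < ereal (real_of_rat a)" "ereal (real_of_rat a) < ereal (real_of_rat b)"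
        using ereal_dense3 by blast
      then have "a < b" by (simp add: of_rat_less)
      with elim a b show False by (auto simp: E_def)
    qed
  qed
qed

end

section \<open>Completeness of \<open>L\<^sup>2\<close>\<close>

text \<open>The norm inequality is nonnegativity of the variance of
  \<open>cmod (u x)\<close>.\<close>

lemma (in prob_space) L1_le_L2_norm:
  assumes u: "sq_integrable M u"
  shows "integrable M (\<lambda>x. cmod (u x))" and "(\<integral>x. cmod (u x) \<partial>M) \<le> L2_norm M u"
proof -
  have u2: "integrable M (\<lambda>x. (cmod (u x))\<^sup>2)" and [measurable]: "u \<in> borel_measurable M"
    using u by (auto simp: sq_integrable_def)
  show i: "integrable M (\<lambda>x. cmod (u x))"
    using sq_integrable_mult[OF u, of "\<lambda>_. 1"] by (simp add: sq_integrable_def)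
  have "0 \<le> variance (\<lambda>x. cmod (u x))" by (rule variance_positive)
  then have "(\<integral>x. cmod (u x) \<partial>M)\<^sup>2 \<le> (\<integral>x. (cmod (u x))\<^sup>2 \<partial>M)"
    using variance_eq[OF i u2] by simp
  then show "(\<integral>x. cmod (u x) \<partial>M) \<le> L2_norm M u"
    by (simp add: L2_norm_def real_le_rsqrt)
qed

lemma nn_integral_L2_norm:
  assumes "sq_integrable M u"
  shows "(\<integral>\<^sup>+x. ennreal ((cmod (u x))\<^sup>2) \<partial>M) = ennreal ((L2_norm M u)\<^sup>2)"
  using assms by (simp add: sq_integrable_def nn_integral_eq_integral L2_norm_def)

text \<open>The hypothesis is a bound on \<open>nn_integral\<close> because this is the form in
  which Fatou's lemma delivers it, before integrability is known.\<close>

lemma sq_integrable_bound: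
  assumes u: "u \<in> borel_measurable M" and c: "0 \<le> c"
    and le: "(\<integral>\<^sup>+x. ennreal ((cmod (u x))\<^sup>2) \<partial>M) \<le> ennreal (c\<^sup>2)"
  shows "sq_integrable M u" and "L2_norm M u \<le> c"
proof -
  show s: "sq_integrable M u"
    unfolding sq_integrable_def
  proof (intro conjI u integrableI_bounded)
    show "(\<lambda>x. (cmod (u x))\<^sup>2) \<in> borel_measurable M" using u by measurable
    show "(\<integral>\<^sup>+x. ennreal (norm ((cmod (u x))\<^sup>2)) \<partial>M) < \<infinity>"
      using le by (simp add: order_le_less_trans)
  qed
  from le have "(L2_norm M u)\<^sup>2 \<le> c\<^sup>2"
    by (simp add: nn_integral_L2_norm[OF s])
  then show "L2_norm M u \<le> c" using c by (rule power2_le_imp_le)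
qed

text \<open>The core of the Riesz-Fischer theorem: the increments have summable L^1 norms, so they
  are almost everywhere absolutely summable and \<open>h\<close> converges pointwise. Fatou's lemma
  in \<open>m\<close> carries the rate over to the limit.\<close>

lemma (in prob_space) fast_Cauchy_L2_limit:
  fixes h :: "nat \<Rightarrow> 'a \<Rightarrow> complex"
  assumes h: "\<And>k. sq_integrable M (h k)"
    and fast: "\<And>k m. k \<le> m \<Longrightarrow> L2_norm M (\<lambda>x. h m x - h k x) \<le> (1/2) ^ k"
  obtains g where "sq_integrable M g" "\<And>k. L2_norm M (\<lambda>x. g x - h k x) \<le> (1/2) ^ k"
proof -
  have hm [measurable]: "h k \<in> borel_measurable M" for k using h[of k] by (simp add: sq_integrable_def)
  \<comment> \<open>Where \<open>h k x\<close> diverges, \<open>lim\<close> is an arbitrary value;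
    this happens only on a null set and does not harm measurability.\<close>
  define g where "g x = lim (\<lambda>k. h k x)" for x
  have gm [measurable]: "g \<in> borel_measurable M"
    unfolding g_def by (rule borel_measurable_lim_metric) simp
  have "(\<integral>\<^sup>+x. (\<Sum>k. ennreal (cmod (h (Suc k) x - h k x))) \<partial>M)
      = (\<Sum>k. \<integral>\<^sup>+x. ennreal (cmod (h (Suc k) x - h k x)) \<partial>M)"
    by (rule nn_integral_suminf) simp
  also have "\<dots> \<le> (\<Sum>k. ennreal ((1/2) ^ k))"
  proof (rule suminf_le)
    fix k
    have d: "sq_integrable M (\<lambda>x. h (Suc k) x - h k x)" by (intro sq_integrable_diff h)
    have "(\<integral>\<^sup>+x. ennreal (cmod (h (Suc k) x - h k x)) \<partial>M)
        = ennreal (\<integral>x. cmod (h (Suc k) x - h k x) \<partial>M)"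
      by (intro nn_integral_eq_integral L1_le_L2_norm d) simp
    also have "\<dots> \<le> ennreal ((1/2) ^ k)"
      using L1_le_L2_norm(2)[OF d] fast[of k "Suc k"] by (intro ennreal_leI) linarith
    finally show "(\<integral>\<^sup>+x. ennreal (cmod (h (Suc k) x - h k x)) \<partial>M) \<le> ennreal ((1/2) ^ k)" .
  qed auto
  also have "\<dots> < \<infinity>"
    by (subst suminf_ennreal2) (auto intro: summable_geometric)
  finally have "AE x in M. (\<Sum>k. ennreal (cmod (h (Suc k) x - h k x))) \<noteq> \<infinity>"
    by (intro nn_integral_noteq_infinite) auto
  then have lim: "AE x in M. (\<lambda>k. h k x) \<longlonglongrightarrow> g x"
  proof eventually_elim
    case (elim x)
    then have "summable (\<lambda>k. cmod (h (Suc k) x - h k x))"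
      by (intro summable_suminf_not_top) auto
    then have "summable (\<lambda>k. h (Suc k) x - h k x)" by (rule summable_norm_cancel)
    then have "convergent (\<lambda>n. \<Sum>k<n. h (Suc k) x - h k x)" by (simp add: summable_iff_convergent)
    then have "convergent (\<lambda>n. h n x - h 0 x)"
      using sum_lessThan_telescope[of "\<lambda>k. h k x"] by simp
    then have "convergent (\<lambda>n. h n x)"
      by (simp add: convergent_diff_const_right_iff)
    then show ?case by (simp add: g_def convergent_LIMSEQ_iff)
  qed
  have bound: "(\<integral>\<^sup>+x. ennreal ((cmod (g x - h k x))\<^sup>2) \<partial>M) \<le> ennreal (((1/2) ^ k)\<^sup>2)" for k
  proof -
    have "(\<integral>\<^sup>+x. ennreal ((cmod (g x - h k x))\<^sup>2) \<partial>M)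
        = (\<integral>\<^sup>+x. liminf (\<lambda>m. ennreal ((cmod (h m x - h k x))\<^sup>2)) \<partial>M)"
    proof (rule nn_integral_cong_AE)
      show "AE x in M. ennreal ((cmod (g x - h k x))\<^sup>2) = liminf (\<lambda>m. ennreal ((cmod (h m x - h k x))\<^sup>2))"
        using lim
      proof eventually_elim
        case (elim x)
        have "(\<lambda>m. ennreal ((cmod (h m x - h k x))\<^sup>2)) \<longlonglongrightarrow> ennreal ((cmod (g x - h k x))\<^sup>2)"
          by (intro tendsto_intros elim tendsto_ennrealI)
        then show ?case by (rule lim_imp_Liminf[OF sequentially_bot, symmetric])
      qed
    qed
    also have "\<dots> \<le> liminf (\<lambda>m. \<integral>\<^sup>+x. ennreal ((cmod (h m x - h k x))\<^sup>2) \<partial>M)"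
      by (rule nn_integral_liminf) simp
    also have "\<dots> \<le> liminf (\<lambda>m. ennreal (((1/2) ^ k)\<^sup>2))"
    proof (rule Liminf_mono)
      show "eventually (\<lambda>m. (\<integral>\<^sup>+x. ennreal ((cmod (h m x - h k x))\<^sup>2) \<partial>M) \<le> ennreal (((1/2) ^ k)\<^sup>2)) sequentially"
        using eventually_ge_at_top[of k]
        by eventually_elim
          (simp add: nn_integral_L2_norm sq_integrable_diff h power_mono fast L2_norm_nonneg del: power_one_over)
    qed
    finally show ?thesis by (simp add: Liminf_const)
  qed
  have "sq_integrable M (\<lambda>x. g x - h 0 x)"
    by (rule sq_integrable_bound(1)[OF _ _ bound]) simp_all
  from sq_integrable_add[OF this h[of 0]] have "sq_integrable M g" by simp
  moreover have "L2_norm M (\<lambda>x. g x - h k x) \<le> (1/2) ^ k" for k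
    by (rule sq_integrable_bound(2)[OF _ _ bound]) simp_all
  ultimately show ?thesis by (rule that)
qed

text \<open>A Cauchy sequence with a convergent subsequence converges, and a subsequence with
  geometric rate is handled by \<open>fast_Cauchy_L2_limit\<close>.\<close>

lemma (in prob_space) mcomplete_L2:
  "Metric_space.mcomplete (L2_space M) (L2_dist M)"
proof -
  interpret L: Metric_space "L2_space M" "L2_dist M" by (rule Metric_space_L2)
  show ?thesis
    unfolding L.mcomplete_def
  proof (intro allI impI)
    fix \<sigma> assume \<sigma>: "L.MCauchy \<sigma>"
    then have "\<forall>n. \<exists>f. sq_integrable M f \<and> \<sigma> n = L2_class M f"
      by (metis L.MCauchy_def L2_spaceE rangeI subsetD)
    then obtain f where f: "\<And>n. sq_integrable M (f n)" "\<And>n. \<sigma> n = L2_class M (f n)" by metis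
    have "\<exists>N. \<forall>n n'. N \<le> n \<longrightarrow> N \<le> n' \<longrightarrow> L2_dist M (\<sigma> n) (\<sigma> n') < (1/2) ^ k" for k
      using \<sigma> unfolding L.MCauchy_def by simp
    then obtain N where N: "\<And>k n n'. N k \<le> n \<Longrightarrow> N k \<le> n' \<Longrightarrow> L2_dist M (\<sigma> n) (\<sigma> n') < (1/2) ^ k"
      by metis
    \<comment> \<open>The sum puts \<open>r k\<close> beyond every \<open>N i\<close> with
      \<open>i \<le> k\<close>; the summand \<open>k\<close> makes \<open>r\<close> strictly
      increasing.\<close>
    define r where "r k = (\<Sum>i\<le>k. N i) + k" for k
    have r: "strict_mono r" by (auto simp: r_def strict_mono_Suc_iff)
    have rN: "N k \<le> r m" if "k \<le> m" for k m
      using member_le_sum[of k "{..m}" N] that by (simp add: r_def)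
    have "L2_norm M (\<lambda>x. f (r m) x - f (r k) x) \<le> (1/2) ^ k" if "k \<le> m" for k m
      using N[OF rN[OF that] rN[of k k]] by (simp add: f L2_dist_class less_imp_le)
    from fast_Cauchy_L2_limit[of "\<lambda>k. f (r k)", OF f(1) this]
    obtain g where g: "sq_integrable M g" "\<And>k. L2_norm M (\<lambda>x. g x - f (r k) x) \<le> (1/2) ^ k" by blast
    have "limitin L.mtopology (\<sigma> \<circ> r) (L2_class M g) sequentially"
      unfolding L.limitin_metric
    proof (intro conjI allI impI)
      show "L2_class M g \<in> L2_space M" by (rule L2_class_in_space[OF g(1)])
      fix \<epsilon> :: real assume "0 < \<epsilon>"
      have "(\<lambda>k. (1/2::real) ^ k) \<longlonglongrightarrow> 0" by (intro LIMSEQ_power_zero) simp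
      then have "eventually (\<lambda>k. (1/2::real) ^ k < \<epsilon>) sequentially"
        using \<open>0 < \<epsilon>\<close> by (rule order_tendstoD)
      then show "eventually (\<lambda>k. (\<sigma> \<circ> r) k \<in> L2_space M \<and> L2_dist M ((\<sigma> \<circ> r) k) (L2_class M g) < \<epsilon>) sequentially"
      proof eventually_elim
        case (elim k)
        have "L2_dist M (\<sigma> (r k)) (L2_class M g) = L2_norm M (\<lambda>x. g x - f (r k) x)"
          by (subst L.commute) (simp add: f L2_dist_class g)
        with g(2)[of k] elim show ?case by (simp add: f L2_class_in_space)
      qed
    qed
    then show "\<exists>x. limitin L.mtopology \<sigma> x sequentially"
      using L.MCauchy_convergent_subsequence[OF \<sigma> r] by blast
  qed
qed

text \<open>In a complete metric space a set has compact closure iff it is totally bounded.\<close>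

lemma (in prob_space) almost_periodic_iff:
  assumes "\<And>n. sq_integrable M (f \<circ> int_iterate M T n)"
  shows "almost_periodic M T f \<longleftrightarrow>
    Metric_space.mtotally_bounded (L2_space M) (L2_dist M)
      (range (\<lambda>n::int. L2_class M (f \<circ> int_iterate M T n)))"
proof -
  interpret L: Metric_space "L2_space M" "L2_dist M" by (rule Metric_space_L2)
  have "range (\<lambda>n. L2_class M (f \<circ> int_iterate M T n)) \<subseteq> L2_space M"
    using assms by (auto simp: L2_class_in_space)
  then show ?thesis
    unfolding almost_periodic_def L2_topology_def
    by (simp add: L.mtotally_bounded_eq_compact_closure_of[OF mcomplete_L2])
qed

section \<open>Mean equicontinuity implies bounded complexity\<close>

context mpt
begin

section \<open>Measurable cells and finite covers by \<open>fbar\<close> balls\<close>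

lemma fbar_measurable:
  assumes [measurable]: "f \<in> borel_measurable M"
  shows "fbar T f n x \<in> borel_measurable M"
  unfolding fbar_def[abs_def] by measurable

lemma fbar_ball_sets:
  assumes "f \<in> borel_measurable M"
  shows "fbar_ball M T f n x \<epsilon> \<in> sets M"
proof -
  note [measurable] = fbar_measurable[OF assms]
  show ?thesis unfolding fbar_ball_def by measurable
qed

text \<open>Divide the plane into small squares and label \<open>x\<close> by the squares that
  contain \<open>f ((T ^^ s) x)\<close> for \<open>s\<close> in \<open>J\<close>. There are
  countably many labels, so they can be coded as natural numbers.\<close>

lemma finite_orbit_cells:
  assumes f [measurable]: "f \<in> borel_measurable M" and "finite J" "0 < \<eta>"
  obtains \<kappa> :: "'a \<Rightarrow> nat" where "\<kappa> \<in> measurable M (count_space UNIV)"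
    and "\<And>x y s. \<kappa> x = \<kappa> y \<Longrightarrow> s \<in> J \<Longrightarrow> cmod (f ((T ^^ s) x) - f ((T ^^ s) y)) < \<eta>"
proof -
  have "\<exists>\<kappa>. \<kappa> \<in> measurable M (count_space (UNIV :: nat set)) \<and>
      (\<forall>x y. \<forall>s\<in>J. \<kappa> x = \<kappa> y \<longrightarrow> cmod (f ((T ^^ s) x) - f ((T ^^ s) y)) < \<eta>)"
    using \<open>finite J\<close>
  proof induction
    case empty
    show ?case by (intro exI[of _ "\<lambda>_. 0"]) simp
  next
    case (insert s J)
    then obtain \<kappa> where k [measurable]: "\<kappa> \<in> measurable M (count_space (UNIV :: nat set))"
      and K: "\<And>x y s. s \<in> J \<Longrightarrow> \<kappa> x = \<kappa> y \<Longrightarrow> cmod (f ((T ^^ s) x) - f ((T ^^ s) y)) < \<eta>" by blast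
    \<comment> \<open>\<open>q z\<close> names the square of side \<open>\<eta> / 2\<close> that
      contains \<open>z\<close>. Points of one square differ by less than \<open>\<eta> / 2\<close>
      in each coordinate, hence by less than \<eta> in modulus.\<close>
    define q where "q z = (\<lfloor>2 * Re z / \<eta>\<rfloor>, \<lfloor>2 * Im z / \<eta>\<rfloor>)" for z
    have q [measurable]: "q \<in> measurable borel (count_space UNIV)"
    proof -
      have "(\<lambda>z. (\<lfloor>2 * Re z / \<eta>\<rfloor>, \<lfloor>2 * Im z / \<eta>\<rfloor>))
          \<in> measurable borel (count_space UNIV \<Otimes>\<^sub>M count_space UNIV)" by measurable
      then show ?thesis unfolding q_def[abs_def] by (simp add: pair_measure_countable)
    qed
    have close: "\<bar>a - b\<bar> < \<eta> / 2" if "\<lfloor>2 * a / \<eta>\<rfloor> = \<lfloor>2 * b / \<eta>\<rfloor>" for a b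
    proof -
      have "\<bar>2 * a / \<eta> - 2 * b / \<eta>\<bar> < 1" using that by linarith
      moreover have "2 * a / \<eta> - 2 * b / \<eta> = (a - b) * (2 / \<eta>)"
        by (simp add: algebra_simps diff_divide_distrib)
      ultimately have "\<bar>(a - b) * (2 / \<eta>)\<bar> < 1" by (simp only:)
      moreover have "\<bar>(a - b) * (2 / \<eta>)\<bar> = \<bar>a - b\<bar> * (2 / \<eta>)"
        using \<open>0 < \<eta>\<close> abs_mult[of "a - b" "2 / \<eta>"] abs_of_pos[of "2 / \<eta>"] by simp
      ultimately have "\<bar>a - b\<bar> * (2 / \<eta>) < 1" by (simp only:)
      then have "\<bar>a - b\<bar> * (2 / \<eta>) * (\<eta> / 2) < 1 * (\<eta> / 2)"
        using \<open>0 < \<eta>\<close> by (intro mult_strict_right_mono) auto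
      then show ?thesis using \<open>0 < \<eta>\<close> by simp
    qed
    have Q: "cmod (z - w) < \<eta>" if "q z = q w" for z w
      using close[of "Re z" "Re w"] close[of "Im z" "Im w"] that cmod_le[of "z - w"]
      by (simp add: q_def)
    define \<kappa>' where "\<kappa>' x = to_nat (\<kappa> x, q (f ((T ^^ s) x)))" for x
    have "(\<lambda>x. (\<kappa> x, q (f ((T ^^ s) x)))) \<in> measurable M (count_space UNIV \<Otimes>\<^sub>M count_space UNIV)"
      by measurable
    then have "(\<lambda>x. (\<kappa> x, q (f ((T ^^ s) x)))) \<in> measurable M (count_space UNIV)"
      by (simp add: pair_measure_countable)
    then have "\<kappa>' \<in> measurable M (count_space UNIV)"
      unfolding \<kappa>'_def[abs_def] by (rule measurable_compose) simp
    moreover have "\<kappa> x = \<kappa> y \<and> q (f ((T ^^ s) x)) = q (f ((T ^^ s) y))" if "\<kappa>' x = \<kappa>' y" for x y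
      using that by (simp add: \<kappa>'_def)
    ultimately show ?case
      using K Q by (intro exI[of _ \<kappa>']) blast
  qed
  then show ?thesis using that by metis
qed

lemma finitely_many_cells:
  assumes [measurable]: "\<kappa> \<in> measurable M (count_space (UNIV :: nat set))" and "0 < \<epsilon>"
  obtains m where "measure M {x \<in> space M. \<kappa> x < m} > 1 - \<epsilon>"
proof -
  have "(\<lambda>m. measure M {x \<in> space M. \<kappa> x < m}) \<longlonglongrightarrow> measure M (\<Union>m. {x \<in> space M. \<kappa> x < m})"
    by (rule finite_Lim_measure_incseq) (auto simp: incseq_def)
  moreover have "(\<Union>m. {x \<in> space M. \<kappa> x < m}) = space M" by auto
  ultimately have "(\<lambda>m. measure M {x \<in> space M. \<kappa> x < m}) \<longlonglongrightarrow> 1" by (simp add: prob_space)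
  then have "eventually (\<lambda>m. 1 - \<epsilon> < measure M {x \<in> space M. \<kappa> x < m}) sequentially"
    by (rule order_tendstoD) (use \<open>0 < \<epsilon>\<close> in simp)
  then show ?thesis using that by (auto simp: eventually_sequentially)
qed

lemma fbar_less:
  assumes "\<And>i. i < n \<Longrightarrow> cmod (f ((T ^^ i) x) - f ((T ^^ i) y)) < \<epsilon>" "0 < \<epsilon>"
  shows "fbar T f n x y < \<epsilon>"
proof (cases "n = 0")
  case False
  then have "(\<Sum>i<n. cmod (f ((T ^^ i) x) - f ((T ^^ i) y))) < (\<Sum>i<n. \<epsilon>)"
    using assms by (intro sum_strict_mono) auto
  with False show ?thesis by (simp add: fbar_def field_simps)
qed (use assms in \<open>simp add: fbar_def\<close>)

text \<open>Points whose orbits share cells at all times below \<open>n\<close> lie in one ball, and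
  finitely many cells carry almost all mass. This serves the finitely many small \<open>n\<close> on
  which an upper limit gives no control.\<close>

lemma finite_cover:
  assumes f: "f \<in> borel_measurable M" and "0 < \<epsilon>"
  obtains F where "finite F" "F \<subseteq> space M" "measure M (\<Union>x\<in>F. fbar_ball M T f n x \<epsilon>) > 1 - \<epsilon>"
proof -
  obtain \<kappa> :: "'a \<Rightarrow> nat" where k [measurable]: "\<kappa> \<in> measurable M (count_space UNIV)"
    and K: "\<And>x y s. \<kappa> x = \<kappa> y \<Longrightarrow> s \<in> {..<n} \<Longrightarrow> cmod (f ((T ^^ s) x) - f ((T ^^ s) y)) < \<epsilon>"
    using finite_orbit_cells[OF f finite_lessThan \<open>0 < \<epsilon>\<close>] by blast
  obtain m where m: "measure M {x \<in> space M. \<kappa> x < m} > 1 - \<epsilon>"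
    using finitely_many_cells[OF k \<open>0 < \<epsilon>\<close>] by blast
  have "\<forall>j\<in>\<kappa> ` space M. \<exists>x\<in>space M. \<kappa> x = j" by auto
  then obtain c where c: "\<And>j. j \<in> \<kappa> ` space M \<Longrightarrow> c j \<in> space M \<and> \<kappa> (c j) = j" by metis
  let ?F = "c ` ({..<m} \<inter> \<kappa> ` space M)"
  have "{x \<in> space M. \<kappa> x < m} \<subseteq> (\<Union>x\<in>?F. fbar_ball M T f n x \<epsilon>)"
  proof
    fix y assume y: "y \<in> {x \<in> space M. \<kappa> x < m}"
    have "fbar T f n (c (\<kappa> y)) y < \<epsilon>"
      by (rule fbar_less[OF _ \<open>0 < \<epsilon>\<close>]) (use K[of "c (\<kappa> y)" y] c[of "\<kappa> y"] y in auto)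
    with y show "y \<in> (\<Union>x\<in>?F. fbar_ball M T f n x \<epsilon>)" by (auto simp: fbar_ball_def)
  qed
  then have "measure M {x \<in> space M. \<kappa> x < m} \<le> measure M (\<Union>x\<in>?F. fbar_ball M T f n x \<epsilon>)"
    by (intro finite_measure_mono sets.finite_UN) (auto simp: fbar_ball_sets[OF f])
  with m c show ?thesis by (intro that[of ?F]) auto
qed

lemma covering_number_le:
  assumes "finite F" "F \<subseteq> space M" "measure M (\<Union>x\<in>F. fbar_ball M T f n x \<epsilon>) > 1 - \<epsilon>"
    and "card F \<le> C"
  shows "covering_number M T f n \<epsilon> \<le> enat C"
proof -
  have "covering_number M T f n \<epsilon> \<le> enat (card F)"
    unfolding covering_number_def by (rule INF_lower) (use assms in auto)
  also have "\<dots> \<le> enat C" using assms by simp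
  finally show ?thesis .
qed

text \<open>The sets \<open>E N\<close> of points that from time \<open>N\<close> on are always
  close to some centre increase and exhaust all \<open>A i\<close>. Hence one \<open>E N\<close> has
  measure above \<open>1 - \<epsilon>\<close>, and the same centres serve every
  \<open>n \<ge> N\<close>.\<close>

lemma mean_equicontinuous_imp_bounded_complexity:
  assumes f: "f \<in> borel_measurable M" and me: "mean_equicontinuous M T f"
  shows "bounded_complexity M T f"
  unfolding bounded_complexity_def
proof (intro allI impI)
  fix \<epsilon> :: real assume e: "0 < \<epsilon>"
  note [measurable] = fbar_measurable[OF f]
  obtain k :: nat and A where A: "\<And>i. i \<in> {1..k} \<Longrightarrow> A i \<in> sets M"
    and mA: "measure M (\<Union>i\<in>{1..k}. A i) > 1 - \<epsilon>"
    and lim: "\<And>i x y. i \<in> {1..k} \<Longrightarrow> x \<in> A i \<Longrightarrow> y \<in> A i \<Longrightarrow>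
      limsup (\<lambda>n. ereal (fbar T f n x y)) < ereal \<epsilon>"
    using me e unfolding mean_equicontinuous_def by meson
  \<comment> \<open>Empty sets have no centre and are dropped.\<close>
  define I where "I = {i \<in> {1..k}. A i \<noteq> {}}"
  have "\<forall>i\<in>I. \<exists>x. x \<in> A i" by (auto simp: I_def)
  then obtain c where c: "\<And>i. i \<in> I \<Longrightarrow> c i \<in> A i" by metis
  have I: "finite I" "I \<subseteq> {1..k}" by (auto simp: I_def)
  have cs: "c ` I \<subseteq> space M"
    using c A I sets.sets_into_space by blast
  have cI: "card (c ` I) \<le> k"
    using card_image_le[OF I(1), of c] card_mono[OF _ I(2)] by simp
  define E where "E N = {y \<in> space M. \<forall>n\<ge>N. \<exists>i\<in>I. fbar T f n (c i) y < \<epsilon>}" for N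
  have Em [measurable]: "E N \<in> sets M" for N
    unfolding E_def using I(1) by measurable
  have "(\<lambda>N. measure M (E N)) \<longlonglongrightarrow> measure M (\<Union>N. E N)"
    by (rule finite_Lim_measure_incseq) (auto simp: incseq_def E_def)
  moreover have "measure M (\<Union>i\<in>{1..k}. A i) \<le> measure M (\<Union>N. E N)"
  proof (rule finite_measure_mono)
    show "(\<Union>i\<in>{1..k}. A i) \<subseteq> (\<Union>N. E N)"
    proof
      fix y assume "y \<in> (\<Union>i\<in>{1..k}. A i)"
      then obtain i where i: "i \<in> {1..k}" "y \<in> A i" by auto
      then have iI: "i \<in> I" by (auto simp: I_def)
      have "eventually (\<lambda>n. ereal (fbar T f n (c i) y) < ereal \<epsilon>) sequentially"
        using lim[OF i(1) c[OF iI] i(2)] by (rule Limsup_lessD)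
      then obtain N where "\<forall>n\<ge>N. fbar T f n (c i) y < \<epsilon>" by (auto simp: eventually_sequentially)
      moreover have "y \<in> space M" using i A sets.sets_into_space by blast
      ultimately have "y \<in> E N" using iI by (auto simp: E_def)
      then show "y \<in> (\<Union>N. E N)" by blast
    qed
  qed auto
  ultimately have "eventually (\<lambda>N. 1 - \<epsilon> < measure M (E N)) sequentially"
    using mA by (intro order_tendstoD(1)[of _ "measure M (\<Union>N. E N)"]) auto
  then obtain N where N: "1 - \<epsilon> < measure M (E N)" by (auto simp: eventually_sequentially)
  have "\<exists>F. finite F \<and> F \<subseteq> space M \<and> measure M (\<Union>x\<in>F. fbar_ball M T f n x \<epsilon>) > 1 - \<epsilon>" for n
    using finite_cover[OF f e] by metis
  then obtain F where F: "\<And>n. finite (F n) \<and> F n \<subseteq> space M \<and>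
      measure M (\<Union>x\<in>F n. fbar_ball M T f n x \<epsilon>) > 1 - \<epsilon>" by metis
  \<comment> \<open>\<open>Suc k\<close> covers \<open>n \<ge> N\<close> and makes \<open>C\<close>
    positive; the sum dominates the cover chosen for each \<open>n < N\<close>.\<close>
  define C where "C = Suc k + (\<Sum>n<N. card (F n))"
  have "covering_number M T f n \<epsilon> \<le> enat C" for n
  proof (cases "n < N")
    case True
    then have "card (F n) \<le> C"
      using member_le_sum[of n "{..<N}" "\<lambda>n. card (F n)"] by (simp add: C_def)
    then show ?thesis using F[of n] by (intro covering_number_le) auto
  next
    case False
    have "E N \<subseteq> (\<Union>x\<in>c ` I. fbar_ball M T f n x \<epsilon>)"
      using False by (auto simp: E_def fbar_ball_def)
    then have "measure M (E N) \<le> measure M (\<Union>x\<in>c ` I. fbar_ball M T f n x \<epsilon>)"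
      using I(1) by (intro finite_measure_mono sets.finite_UN) (auto simp: fbar_ball_sets[OF f])
    then show ?thesis
      using N I(1) cs cI by (intro covering_number_le[where F = "c ` I"]) (auto simp: C_def)
  qed
  then show "\<exists>C>0. \<forall>n\<ge>1. covering_number M T f n \<epsilon> \<le> enat C"
    by (intro exI[of _ C]) (auto simp: C_def)
qed

end

section \<open>Bounded complexity implies almost periodicity\<close>

text \<open>Project the values of \<open>f\<close> onto a large disc. The projection is 1-Lipschitz,
  so \<open>fbar\<close> does not increase, and its distance to the identity is at most the modulus,
  so dominated convergence gives L^2 approximation.\<close>

lemma sq_integrable_truncation:
  assumes f: "sq_integrable M f" and "0 < \<epsilon>"
  obtains g R where "g \<in> borel_measurable M" "0 < R" "\<And>x. cmod (g x) \<le> R"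
    "\<And>x y. cmod (g x - g y) \<le> cmod (f x - f y)"
    "sq_integrable M g" "L2_norm M (\<lambda>x. f x - g x) < \<epsilon>"
proof -
  define g where "g n x = closest_point (cball 0 (real (Suc n))) (f x)" for n x
  have fm [measurable]: "f \<in> borel_measurable M" and f2: "integrable M (\<lambda>x. (cmod (f x))\<^sup>2)"
    using f by (auto simp: sq_integrable_def)
  have "closest_point (cball 0 (real (Suc n))) \<in> borel_measurable (borel :: complex measure)" for n
    by (intro borel_measurable_continuous_onI continuous_on_closest_point) auto
  from measurable_compose[OF fm this]
  have gm [measurable]: "g n \<in> borel_measurable M" for n
    by (simp add: g_def[abs_def])
  have bound: "cmod (g n x) \<le> real (Suc n)" for n x
    using closest_point_in_set[of "cball 0 (real (Suc n))" "f x"] by (simp add: g_def)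
  have lip: "cmod (g n x - g n y) \<le> cmod (f x - f y)" for n x y
    using closest_point_lipschitz[of "cball 0 (real (Suc n))" "f x" "f y"] by (simp add: g_def dist_norm)
  have near: "cmod (f x - g n x) \<le> cmod (f x)" for n x
    using closest_point_le[of "cball 0 (real (Suc n))" 0 "f x"] by (simp add: g_def dist_norm)
  have "(\<lambda>n. \<integral>x. (cmod (f x - g n x))\<^sup>2 \<partial>M) \<longlonglongrightarrow> (\<integral>x. 0 \<partial>M)"
  proof (rule integral_dominated_convergence[OF _ _ f2])
    show "AE x in M. (\<lambda>n. (cmod (f x - g n x))\<^sup>2) \<longlonglongrightarrow> 0"
    proof (rule AE_I2)
      fix x
      obtain N where N: "cmod (f x) < real N" using reals_Archimedean2 by blast
      have "f x = g n x" if "N \<le> n" for n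
        using N that closest_point_self[of "f x" "cball 0 (real (Suc n))"] by (simp add: g_def)
      then have "eventually (\<lambda>n. (cmod (f x - g n x))\<^sup>2 = 0) sequentially"
        by (auto simp: eventually_sequentially)
      then show "(\<lambda>n. (cmod (f x - g n x))\<^sup>2) \<longlonglongrightarrow> 0" by (rule tendsto_eventually)
    qed
    show "AE x in M. norm ((cmod (f x - g n x))\<^sup>2) \<le> (cmod (f x))\<^sup>2" for n
      using near by (intro AE_I2) (simp add: power_mono)
  qed auto
  then have "eventually (\<lambda>n. (\<integral>x. (cmod (f x - g n x))\<^sup>2 \<partial>M) < \<epsilon>\<^sup>2) sequentially"
    using \<open>0 < \<epsilon>\<close> by (intro order_tendstoD(2)) auto
  then obtain n where "(\<integral>x. (cmod (f x - g n x))\<^sup>2 \<partial>M) < \<epsilon>\<^sup>2" by (auto simp: eventually_sequentially)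
  then have "L2_norm M (\<lambda>x. f x - g n x) < \<epsilon>"
    unfolding L2_norm_def using \<open>0 < \<epsilon>\<close> by (simp add: real_less_lsqrt)
  moreover have "sq_integrable M (\<lambda>x. f x - g n x)"
    unfolding sq_integrable_def
  proof
    show "integrable M (\<lambda>x. (cmod (f x - g n x))\<^sup>2)"
      by (rule Bochner_Integration.integrable_bound[OF f2]) (use near in \<open>auto intro!: AE_I2 power_mono\<close>)
  qed simp
  from sq_integrable_diff[OF f this] have "sq_integrable M (g n)" by simp
  ultimately show ?thesis
    using bound lip by (intro that[of "g n" "real (Suc n)"]) auto
qed

text \<open>Pointwise, \<open>(cmod (u x))\<^sup>2 \<le> R * cmod (u x)\<close>. This is how L^1
  closeness of bounded functions becomes L^2 closeness.\<close>

lemma L2_norm_bounded: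
  assumes u: "u \<in> borel_measurable M" "integrable M (\<lambda>x. cmod (u x))"
    and R: "\<And>x. cmod (u x) \<le> R"
  shows "(L2_norm M u)\<^sup>2 \<le> R * (\<integral>x. cmod (u x) \<partial>M)"
proof -
  have le: "(cmod (u x))\<^sup>2 \<le> R * cmod (u x)" for x
    using R[of x] by (simp add: power2_eq_square mult_right_mono)
  have "integrable M (\<lambda>x. R * cmod (u x))" using u by simp
  moreover from this have "integrable M (\<lambda>x. (cmod (u x))\<^sup>2)"
    by (rule Bochner_Integration.integrable_bound)
      (use u le in \<open>auto intro!: AE_I2 order_trans[OF le abs_ge_self]\<close>)
  ultimately have "(\<integral>x. (cmod (u x))\<^sup>2 \<partial>M) \<le> (\<integral>x. R * cmod (u x) \<partial>M)"
    by (intro integral_mono le)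
  then show ?thesis by (simp add: L2_norm_def)
qed

text \<open>If two translates of the separated set \<open>S\<close> by elements of \<open>I \<subseteq> {..<n}\<close> met, two separated
  points would be as close as two points of \<open>I\<close>; so \<open>card I * card S\<close> is at most about \<open>n\<close>.\<close>

lemma separated_card_le:
  fixes D :: "int \<Rightarrow> int \<Rightarrow> real"
  assumes inv: "\<And>i j k. D (i + k) (j + k) = D i j"
    and close: "\<And>n. \<exists>I\<subseteq>{..<n}. n \<le> K * card I \<and> (\<forall>i\<in>I. \<forall>j\<in>I. D (int i) (int j) < \<epsilon>)"
    and S: "finite S" "\<And>a b. a \<in> S \<Longrightarrow> b \<in> S \<Longrightarrow> a \<noteq> b \<Longrightarrow> \<epsilon> \<le> D a b"
  shows "card S \<le> K"
proof (rule ccontr)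
  assume "\<not> card S \<le> K"
  then have K: "Suc K \<le> card S" by simp
  define m where "m = (\<Sum>s\<in>S. nat \<bar>s\<bar>)"
  have m: "\<bar>s\<bar> \<le> int m" if "s \<in> S" for s
  proof -
    have "nat \<bar>s\<bar> \<le> m"
      unfolding m_def using S(1) that by (intro member_le_sum) auto
    then show ?thesis by simp
  qed
  \<comment> \<open>The count below yields \<open>n \<le> 2 * m * K\<close>, which this value just
    violates.\<close>
  define n where "n = 2 * m * K + 1"
  obtain I where I: "I \<subseteq> {..<n}" "n \<le> K * card I"
    and cl: "\<And>i j. i \<in> I \<Longrightarrow> j \<in> I \<Longrightarrow> D (int i) (int j) < \<epsilon>" using close[of n] by meson
  have "inj_on (\<lambda>(i, s). int i + s) (I \<times> S)"
  proof (rule inj_onI, clarify)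
    fix i s i' s' assume *: "i \<in> I" "s \<in> S" "i' \<in> I" "s' \<in> S" and eq: "int i + s = int i' + s'"
    \<comment> \<open>Translating the pair \<open>(i', i)\<close> by \<open>s' - int i\<close>
      produces \<open>(s, s')\<close>, so the two pairs have the same distance.\<close>
    have "int i' + (s' - int i) = s" "int i + (s' - int i) = s'" using eq by auto
    then have "D s s' = D (int i') (int i)"
      using inv[of "int i'" "s' - int i" "int i"] by simp
    with cl[OF *(3,1)] S(2)[OF *(2,4)] have "s = s'" by fastforce
    with eq show "i = i' \<and> s = s'" by simp
  qed
  then have "card I * card S = card ((\<lambda>(i, s). int i + s) ` (I \<times> S))"
    by (simp add: card_image card_cartesian_product)
  also have "\<dots> \<le> card {- int m..<int n + int m}"
  proof (rule card_mono)
    show "(\<lambda>(i, s). int i + s) ` (I \<times> S) \<subseteq> {- int m..<int n + int m}"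
    proof clarsimp
      fix i s assume "i \<in> I" "s \<in> S"
      then have "i < n" "\<bar>s\<bar> \<le> int m" using I(1) m by auto
      then show "- int m \<le> int i + s \<and> int i + s < int n + int m" by linarith
    qed
  qed simp
  also have "\<dots> = n + 2 * m" by simp
  finally have IS: "card I * card S \<le> n + 2 * m" .
  have "n * Suc K \<le> n * card S" using K by (rule mult_le_mono2)
  also have "\<dots> \<le> K * card I * card S" using I(2) by (rule mult_le_mono1)
  also have "\<dots> \<le> K * (n + 2 * m)" using IS by (simp add: mult.assoc)
  finally have "n * Suc K \<le> K * (n + 2 * m)" .
  then have "n \<le> 2 * m * K" by (simp add: algebra_simps)
  then show False by (simp add: n_def)
qed

text \<open>A separated set of maximal cardinality is a net, since any index far from it could be
  added. Separation is counted on indices, where translation by integers makes sense in the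
  application.\<close>

lemma (in Metric_space) mtotally_bounded_separated:
  assumes X: "range X \<subseteq> M"
    and sep: "\<And>\<epsilon>. 0 < \<epsilon> \<Longrightarrow> \<exists>K::nat. \<forall>S. finite S \<longrightarrow>
      (\<forall>a\<in>S. \<forall>b\<in>S. a \<noteq> b \<longrightarrow> \<epsilon> \<le> d (X a) (X b)) \<longrightarrow> card S \<le> K"
  shows "mtotally_bounded (range X)"
  unfolding mtotally_bounded_def
proof (intro allI impI)
  fix \<epsilon> :: real assume e: "0 < \<epsilon>"
  define P where "P S \<longleftrightarrow> finite S \<and> (\<forall>a\<in>S. \<forall>b\<in>S. a \<noteq> b \<longrightarrow> \<epsilon> \<le> d (X a) (X b))" for S
  obtain K where K: "\<And>S. P S \<Longrightarrow> card S < Suc K"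
    using sep[OF e] by (auto simp: P_def less_Suc_eq_le)
  have "P {}" by (simp add: P_def)
  from ex_has_greatest_nat[of P "{}" card "Suc K", OF this] K
  obtain S where S: "P S" and max: "\<And>S'. P S' \<Longrightarrow> card S' \<le> card S" by blast
  have "\<exists>s\<in>S. d (X s) (X n) < \<epsilon>" for n
  proof (rule ccontr)
    assume neg: "\<not> ?thesis"
    then have "n \<notin> S" using e X by (metis mdist_zero rangeI subsetD)
    moreover have "P (insert n S)" using S neg by (auto simp: P_def commute not_less)
    ultimately show False using max[of "insert n S"] S by (simp add: P_def)
  qed
  then have "range X \<subseteq> (\<Union>x\<in>X ` S. mball x \<epsilon>)" using X by fastforce
  with S show "\<exists>K. finite K \<and> K \<subseteq> range X \<and> range X \<subseteq> (\<Union>x\<in>K. mball x \<epsilon>)"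
    by (intro exI[of _ "X ` S"]) (auto simp: P_def)
qed

section \<open>Clusters of close iterates from bounded complexity\<close>

context mpt
begin

lemma sq_integrable_funpow:
  "sq_integrable M u \<Longrightarrow> sq_integrable M (\<lambda>x. u ((T ^^ n) x))"
  using integrable_funpow[of "\<lambda>x. (cmod (u x))\<^sup>2" n]
  by (auto simp: sq_integrable_def)

lemma L2_norm_funpow:
  "u \<in> borel_measurable M \<Longrightarrow> L2_norm M (\<lambda>x. u ((T ^^ n) x)) = L2_norm M u"
  using integral_funpow[of "\<lambda>x. (cmod (u x))\<^sup>2" n] by (simp add: L2_norm_def)

text \<open>The times \<open>i < n\<close> are coloured by the quantized values of \<open>g\<close> along the orbits of the centres;
  times of the same colour give nearby functions up to the error \<open>e i\<close>, which is small for
  at least half of them.\<close>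

lemma many_close_iterates:
  assumes g [measurable]: "g \<in> borel_measurable M" and "0 < R" and R: "\<And>x. cmod (g x) \<le> R"
    and d: "0 < \<delta>"
    and cov: "\<And>n. 1 \<le> n \<Longrightarrow> \<exists>F. finite F \<and> F \<subseteq> space M \<and> card F \<le> C \<and>
      measure M (\<Union>x\<in>F. fbar_ball M T g n x \<delta>) > 1 - \<delta>"
  shows "\<exists>K. \<forall>n. \<exists>I\<subseteq>{..<n}. n \<le> K * card I \<and> (\<forall>i\<in>I. \<forall>j\<in>I.
    (\<integral>x. cmod (g ((T ^^ i) x) - g ((T ^^ j) x)) \<partial>M) \<le> (6 + 2 * R) * \<delta>)"
proof -
  have "compact (cball (0::complex) R)" by simp
  then obtain Q where Q: "finite Q" "cball (0::complex) R \<subseteq> (\<Union>z\<in>Q. ball z \<delta>)"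
    using d unfolding compact_eq_totally_bounded by blast
  then have "Q \<noteq> {}" using \<open>0 < R\<close> by fastforce
  have "\<exists>z\<in>Q. dist z (g x) < \<delta>" for x
    using Q(2) R[of x] by (auto simp: subset_iff)
  then obtain q where q: "\<And>x. q x \<in> Q" "\<And>x. dist (q x) (g x) < \<delta>" by metis
  show ?thesis
  \<comment> \<open>The factor 2 pays for discarding the bad times, at most half of them;
    \<open>card Q ^ C\<close> bounds the number of colours.\<close>
  proof (intro exI[of _ "2 * card Q ^ C"] allI)
    fix n :: nat
    consider "n = 0" | "1 \<le> n" by linarith
    then show "\<exists>I\<subseteq>{..<n}. n \<le> 2 * card Q ^ C * card I \<and> (\<forall>i\<in>I. \<forall>j\<in>I.
        (\<integral>x. cmod (g ((T ^^ i) x) - g ((T ^^ j) x)) \<partial>M) \<le> (6 + 2 * R) * \<delta>)"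
    proof cases
      case 2
      obtain F where F: "finite F" "F \<subseteq> space M" "card F \<le> C"
        and mF: "measure M (\<Union>x\<in>F. fbar_ball M T g n x \<delta>) > 1 - \<delta>" using cov[OF 2] by blast
      define c where "c = card F"
      obtain h where h: "bij_betw h {0..<c} F"
        unfolding c_def using ex_bij_betw_nat_finite[OF F(1)] by blast
      define B where "B j = fbar_ball M T g n (h j) \<delta>" for j
      have [measurable]: "B j \<in> sets M" for j unfolding B_def by (rule fbar_ball_sets[OF g])
      define G where "G = (\<Union>j\<in>{..<c}. B j)"
      have [measurable]: "G \<in> sets M" unfolding G_def by measurable
      have "F = h ` {..<c}" using bij_betw_imp_surj_on[OF h] by (simp add: atLeast0LessThan)
      then have "G = (\<Union>x\<in>F. fbar_ball M T g n x \<delta>)" by (simp add: G_def B_def)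
      with mF have mG: "1 - \<delta> < measure M G" by simp
      \<comment> \<open>A measurable choice of a centre whose ball contains \<open>y\<close>. Off
        \<open>G\<close> its value is irrelevant, being masked by the indicator of
        \<open>G\<close>.\<close>
      define k where "k y = (LEAST j. j < c \<and> y \<in> B j)" for y
      have [measurable]: "k \<in> measurable M (count_space UNIV)"
        unfolding k_def[abs_def] by measurable
      have k: "k y < c \<and> y \<in> B (k y)" if "y \<in> G" for y
        using that LeastI_ex[of "\<lambda>j. j < c \<and> y \<in> B j"] by (auto simp: G_def k_def)
      define u where "u i y = cmod (g ((T ^^ i) (h (k y))) - g ((T ^^ i) y))" for i y
      have [measurable]: "(\<lambda>y. g ((T ^^ i) (h (k y)))) \<in> borel_measurable M" for i
        by (rule measurable_compose[of k M "count_space UNIV"]) simp_all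
      have um [measurable]: "u i \<in> borel_measurable M" for i
        unfolding u_def[abs_def] by measurable
      have diff: "cmod (g x - g y) \<le> 2 * R" for x y
        using norm_triangle_ineq4[of "g x" "g y"] R[of x] R[of y] by linarith
      have ui: "integrable M (\<lambda>y. indicator G y * u i y)" for i
        by (rule integrable_const_bound[where B = "2 * R"])
          (use diff \<open>0 < R\<close> in \<open>auto simp: u_def indicator_def\<close>)
      define e where "e i = (\<integral>y. indicator G y * u i y \<partial>M)" for i
      have e0: "0 \<le> e i" for i unfolding e_def by (rule Bochner_Integration.integral_nonneg) (simp add: u_def)
      have "(\<Sum>i<n. e i) = (\<integral>y. (\<Sum>i<n. indicator G y * u i y) \<partial>M)"
        unfolding e_def by (rule Bochner_Integration.integral_sum[symmetric]) (rule ui)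
      also have "\<dots> \<le> real n * \<delta>"
      proof (rule integral_le_const)
        show "integrable M (\<lambda>y. \<Sum>i<n. indicator G y * u i y)"
          by (rule Bochner_Integration.integrable_sum) (rule ui)
        show "AE y in M. (\<Sum>i<n. indicator G y * u i y) \<le> real n * \<delta>"
        proof (rule AE_I2)
          fix y
          show "(\<Sum>i<n. indicator G y * u i y) \<le> real n * \<delta>"
          proof (cases "y \<in> G")
            case True
            then have "fbar T g n (h (k y)) y < \<delta>" using k[OF True] by (simp add: B_def fbar_ball_def)
            with 2 have "(\<Sum>i<n. u i y) \<le> real n * \<delta>"
              by (simp add: fbar_def u_def field_simps)
            with True show ?thesis by simp
          qed (use d in simp)
        qed
      qed
      finally have sum_e: "(\<Sum>i<n. e i) \<le> real n * \<delta>" .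
      \<comment> \<open>Markov's inequality for the counting measure: the \<open>e i\<close> sum to
        at most \<open>n * \<delta>\<close>, so at most half of them exceed
        \<open>2 * \<delta>\<close>.\<close>
      define J where "J = {i\<in>{..<n}. e i \<le> 2 * \<delta>}"
      have J: "finite J" "J \<subseteq> {..<n}" by (auto simp: J_def)
      have "real (card ({..<n} - J)) * (2 * \<delta>) = (\<Sum>i\<in>{..<n} - J. 2 * \<delta>)" by simp
      also have "\<dots> \<le> (\<Sum>i\<in>{..<n} - J. e i)" by (rule sum_mono) (auto simp: J_def)
      also have "\<dots> \<le> (\<Sum>i<n. e i)" by (rule sum_mono2) (use e0 in auto)
      also note sum_e
      finally have "2 * real (card ({..<n} - J)) \<le> real n" using d by simp
      then have J2: "n \<le> 2 * card J"
        using J card_mono[OF _ J(2)] by (simp add: card_Diff_subset)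
      \<comment> \<open>Restricting the domain to \<open>{..<c}\<close> places the colours in a
        finite function space.\<close>
      define col where "col i = (\<lambda>j\<in>{..<c}. q ((T ^^ i) (h j)))" for i
      have "col \<in> J \<rightarrow> PiE {..<c} (\<lambda>_. Q)" using q(1) by (auto simp: col_def)
      moreover have "finite (PiE {..<c} (\<lambda>_. Q))" using Q(1) by (intro finite_PiE) auto
      moreover have "PiE {..<c} (\<lambda>_. Q) \<noteq> {}" using \<open>Q \<noteq> {}\<close> by (simp add: PiE_eq_empty_iff)
      ultimately obtain v where v: "card J \<le> card (col -` {v} \<inter> J) * card (PiE {..<c} (\<lambda>_. Q))"
        using pigeonhole_card[of col J "PiE {..<c} (\<lambda>_. Q)"] J(1) by blast
      define I where "I = col -` {v} \<inter> J"
      have "card (PiE {..<c} (\<lambda>_. Q)) = card Q ^ c" by (simp add: card_PiE)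
      also have "\<dots> \<le> card Q ^ C"
        using F(3) Q(1) \<open>Q \<noteq> {}\<close> by (intro power_increasing) (auto simp: c_def Suc_le_eq card_gt_0_iff)
      finally have "card J \<le> card I * card Q ^ C"
        using v by (simp add: I_def) (meson le_trans mult_le_mono2)
      with J2 have nI: "n \<le> 2 * card Q ^ C * card I" by (simp add: algebra_simps)
      have close: "(\<integral>x. cmod (g ((T ^^ i) x) - g ((T ^^ j) x)) \<partial>M) \<le> (6 + 2 * R) * \<delta>"
        if i: "i \<in> I" and j: "j \<in> I" for i j
      proof -
        have "(\<integral>x. cmod (g ((T ^^ i) x) - g ((T ^^ j) x)) \<partial>M)
          \<le> (\<integral>x. indicator G x * u i x + indicator G x * u j x
              + (2 * \<delta> + 2 * R * indicator (space M - G) x) \<partial>M)"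
        proof (rule integral_mono)
          show "integrable M (\<lambda>x. cmod (g ((T ^^ i) x) - g ((T ^^ j) x)))"
            by (rule integrable_const_bound[where B = "2 * R"]) (use diff in auto)
          show "integrable M (\<lambda>x. indicator G x * u i x + indicator G x * u j x
              + (2 * \<delta> + 2 * R * indicator (space M - G) x))"
            using ui by (intro Bochner_Integration.integrable_add) (auto simp: integrable_indicator_iff emeasure_eq_measure)
          fix x assume x: "x \<in> space M"
          show "cmod (g ((T ^^ i) x) - g ((T ^^ j) x)) \<le> indicator G x * u i x + indicator G x * u j x
              + (2 * \<delta> + 2 * R * indicator (space M - G) x)"
          proof (cases "x \<in> G")
            case True
            from i j have "col i = col j" by (simp add: I_def)
            then have "col i (k x) = col j (k x)" by simp
            then have eq: "q ((T ^^ i) (h (k x))) = q ((T ^^ j) (h (k x)))"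
              using k[OF True] by (simp add: col_def)
            \<comment> \<open>Go from \<open>x\<close> to its centre at time \<open>i\<close>,
              through the common quantized value, and back from the centre at time \<open>j\<close>.
              The two quantization errors give \<open>2 * \<delta>\<close>.\<close>
            have "dist (g ((T ^^ i) x)) (g ((T ^^ j) x)) \<le> u i x + u j x + 2 * \<delta>"
              using q(2)[of "(T ^^ i) (h (k x))"] q(2)[of "(T ^^ j) (h (k x))"]
                eq
              unfolding u_def dist_norm[symmetric] by metric
            with True show ?thesis by (simp add: dist_norm)
          next
            case False
            with diff[of "(T ^^ i) x" "(T ^^ j) x"] d x show ?thesis by simp
          qed
        qed
        also have "\<dots> = e i + e j + (2 * \<delta> + 2 * R * measure M (space M - G))"
          unfolding e_def
          by (subst Bochner_Integration.integral_add Bochner_Integration.integrable_add,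
              (use ui in \<open>auto simp: integrable_indicator_iff emeasure_eq_measure prob_space\<close>)[2])+
            (use ui in \<open>simp add: integrable_indicator_iff emeasure_eq_measure prob_space\<close>)
        also have "\<dots> \<le> 2 * \<delta> + 2 * \<delta> + (2 * \<delta> + 2 * R * \<delta>)"
        proof -
          have "measure M (space M - G) \<le> \<delta>" using mG by (subst prob_compl) auto
          then have "2 * R * measure M (space M - G) \<le> 2 * R * \<delta>"
            using \<open>0 < R\<close> by (intro mult_left_mono) auto
          with i j show ?thesis by (simp add: I_def J_def)
        qed
        finally show ?thesis by (simp add: algebra_simps)
      qed
      have "I \<subseteq> {..<n}" using J by (auto simp: I_def)
      with nI close show ?thesis by (intro exI[of _ I]) blast
    qed auto
  qed
qed

text \<open>Balls for \<open>f\<close> lie inside the balls for its truncation \<open>g\<close>, so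
  covers are inherited. The iterates of \<open>g\<close> are then L^1 close, hence L^2 close by
  boundedness, and by invariance each replacement of \<open>f\<close> by \<open>g\<close> costs at
  most \<open>\<epsilon> / 4\<close>.\<close>

lemma bounded_complexity_close_iterates:
  assumes f: "sq_integrable M f" and bc: "bounded_complexity M T f" and e: "0 < \<epsilon>"
  shows "\<exists>K. \<forall>n. \<exists>I\<subseteq>{..<n}. n \<le> K * card I \<and> (\<forall>i\<in>I. \<forall>j\<in>I.
    L2_norm M (\<lambda>x. f ((T ^^ i) x) - f ((T ^^ j) x)) < \<epsilon>)"
proof -
  obtain g R where g [measurable]: "g \<in> borel_measurable M" and R: "0 < R" "\<And>x. cmod (g x) \<le> R"
    and lip: "\<And>x y. cmod (g x - g y) \<le> cmod (f x - f y)"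
    and g2: "sq_integrable M g" and fg: "L2_norm M (\<lambda>x. f x - g x) < \<epsilon> / 4"
    using sq_integrable_truncation[OF f, of "\<epsilon> / 4"] e by auto
  have fm [measurable]: "f \<in> borel_measurable M" using f by (simp add: sq_integrable_def)
  \<comment> \<open>Chosen so that the bound \<open>(6 + 2 * R) * \<delta>\<close>, multiplied by
    the sup bound \<open>2 * R\<close> for differences of \<open>g\<close>, is
    \<open>\<epsilon>\<^sup>2 / 8\<close>, below the square of
    \<open>\<epsilon> / 2\<close>.\<close>
  define \<delta> where "\<delta> = \<epsilon>\<^sup>2 / (8 * (2 * R * (6 + 2 * R)))"
  have pos: "0 < 2 * R * (6 + 2 * R)" using R by simp
  then have d: "0 < \<delta>" using e by (simp add: \<delta>_def)
  have d2: "2 * R * ((6 + 2 * R) * \<delta>) = \<epsilon>\<^sup>2 / 8"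
    using pos R by (simp add: \<delta>_def field_simps)
  obtain C :: nat where C: "\<And>n. 1 \<le> n \<Longrightarrow> covering_number M T f n \<delta> \<le> enat C"
    using bc d unfolding bounded_complexity_def by blast
  have "\<exists>F. finite F \<and> F \<subseteq> space M \<and> card F \<le> C \<and>
      measure M (\<Union>x\<in>F. fbar_ball M T g n x \<delta>) > 1 - \<delta>" if "1 \<le> n" for n
  proof -
    have "covering_number M T f n \<delta> < enat (Suc C)"
      using C[OF that] by (rule order_le_less_trans) simp
    then obtain F where F: "finite F" "F \<subseteq> space M" "card F \<le> C"
      "measure M (\<Union>x\<in>F. fbar_ball M T f n x \<delta>) > 1 - \<delta>"
      unfolding covering_number_def INF_less_iff by auto
    have "fbar T g n x y \<le> fbar T f n x y" for x y
      unfolding fbar_def by (intro mult_left_mono sum_mono lip) simp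
    then have "fbar_ball M T f n x \<delta> \<subseteq> fbar_ball M T g n x \<delta>" for x
      by (auto simp: fbar_ball_def intro: order_le_less_trans)
    then have "measure M (\<Union>x\<in>F. fbar_ball M T f n x \<delta>) \<le> measure M (\<Union>x\<in>F. fbar_ball M T g n x \<delta>)"
      using F(1) by (intro finite_measure_mono sets.finite_UN) (auto simp: fbar_ball_sets[OF g])
    with F show ?thesis by (intro exI[of _ F]) auto
  qed
  from many_close_iterates[OF g R d this] obtain K where K:
    "\<And>n. \<exists>I\<subseteq>{..<n}. n \<le> K * card I \<and> (\<forall>i\<in>I. \<forall>j\<in>I.
      (\<integral>x. cmod (g ((T ^^ i) x) - g ((T ^^ j) x)) \<partial>M) \<le> (6 + 2 * R) * \<delta>)" by blast
  have "L2_norm M (\<lambda>x. f ((T ^^ i) x) - f ((T ^^ j) x)) < \<epsilon>"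
    if le: "(\<integral>x. cmod (g ((T ^^ i) x) - g ((T ^^ j) x)) \<partial>M) \<le> (6 + 2 * R) * \<delta>" for i j
  proof -
    let ?fi = "\<lambda>i x. f ((T ^^ i) x)" and ?gi = "\<lambda>i x. g ((T ^^ i) x)"
    have s: "sq_integrable M (?fi i)" "sq_integrable M (?gi i)" for i
      using f g2 by (simp_all add: sq_integrable_funpow)
    have fgi: "L2_norm M (\<lambda>x. ?fi i x - ?gi i x) < \<epsilon> / 4" for i
      using L2_norm_funpow[of "\<lambda>x. f x - g x" i] fg by simp
    have "(L2_norm M (\<lambda>x. ?gi i x - ?gi j x))\<^sup>2 \<le> 2 * R * (\<integral>x. cmod (?gi i x - ?gi j x) \<partial>M)"
    proof (rule L2_norm_bounded)
      show "integrable M (\<lambda>x. cmod (?gi i x - ?gi j x))"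
        by (intro L1_le_L2_norm sq_integrable_diff s)
      show "cmod (?gi i x - ?gi j x) \<le> 2 * R" for x
        using norm_triangle_ineq4[of "?gi i x" "?gi j x"] R(2)[of "(T ^^ i) x"] R(2)[of "(T ^^ j) x"]
        by linarith
    qed simp
    also have "\<dots> \<le> 2 * R * ((6 + 2 * R) * \<delta>)" using le R by (intro mult_left_mono) auto
    also have "\<dots> < (\<epsilon> / 2)\<^sup>2" unfolding d2 using e by (simp add: power2_eq_square)
    finally have gg: "L2_norm M (\<lambda>x. ?gi i x - ?gi j x) < \<epsilon> / 2"
      by (rule power2_less_imp_less) (use e in simp)
    interpret L: Metric_space "L2_space M" "L2_dist M" by (rule Metric_space_L2)
    have "L2_dist M (L2_class M (?fi i)) (L2_class M (?fi j))
        \<le> L2_dist M (L2_class M (?fi i)) (L2_class M (?gi i))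
        + L2_dist M (L2_class M (?gi i)) (L2_class M (?gi j))
        + L2_dist M (L2_class M (?fi j)) (L2_class M (?gi j))"
      using L.triangle[of "L2_class M (?fi i)" "L2_class M (?gi i)" "L2_class M (?fi j)"]
        L.triangle[of "L2_class M (?gi i)" "L2_class M (?gi j)" "L2_class M (?fi j)"]
        L.commute[of "L2_class M (?fi j)" "L2_class M (?gi j)"]
      by (simp add: L2_class_in_space s)
    with fgi[of i] fgi[of j] gg show ?thesis by (simp add: L2_dist_class s)
  qed
  with K show ?thesis by meson
qed

end

section \<open>Integer iterates and translation invariance along the orbit\<close>

lemma int_iterate_add1:
  assumes T: "bij_betw T (space M) (space M)" and x: "x \<in> space M"
  shows "int_iterate M T (n + 1) x = int_iterate M T n (T x)"
proof (cases "0 \<le> n")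
  case True
  then show ?thesis by (simp add: int_iterate_def nat_add_distrib funpow_swap1)
next
  case False
  then have "n = - 1 - int (nat (- 1 - n))" by simp
  then obtain k where k: "n = - 1 - int k" by blast
  have inv: "the_inv_into (space M) T (T x) = x"
    using T x by (simp add: the_inv_into_f_f bij_betw_def)
  have nk: "nat (- n) = Suc k" using k by simp
  have "int_iterate M T n (T x) = (the_inv_into (space M) T ^^ Suc k) (T x)"
    using False by (simp add: int_iterate_def nk)
  then have "int_iterate M T n (T x) = (the_inv_into (space M) T ^^ k) x"
    by (simp only: funpow_Suc_right comp_apply inv)
  \<comment> \<open>For \<open>k = 0\<close> the exponent \<open>n + 1\<close> is 0 and falls into
    the nonnegative branch of \<open>int_iterate\<close>, hence the case split.\<close>
  moreover have "int_iterate M T (n + 1) x = (the_inv_into (space M) T ^^ k) x"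
    using k by (cases k) (auto simp: int_iterate_def nat_add_distrib)
  ultimately show ?thesis by simp
qed

locale invertible_mpt_space = mpt +
  assumes invertible: "invertible_mpt M T"
begin

lemma inverse_mpt: "mpt M (the_inv_into (space M) T)"
proof
  let ?S = "the_inv_into (space M) T"
  show S: "?S \<in> measurable M M" using invertible by (simp add: invertible_mpt_def)
  have inj: "inj_on T (space M)" using invertible by (simp add: invertible_mpt_def bij_betw_def)
  have "distr M M ?S = distr (distr M M T) M ?S" by (simp only: T_distr)
  also have "\<dots> = distr M M (?S \<circ> T)" by (rule distr_distr[OF S T_measurable])
  also have "\<dots> = distr M M (\<lambda>x. x)"
    by (rule distr_cong) (simp_all add: the_inv_into_f_f[OF inj])
  also have "\<dots> = M" by (rule distr_id2) simp
  finally show "distr M M ?S = M" .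
qed

lemma sq_integrable_int_iterate:
  "sq_integrable M f \<Longrightarrow> sq_integrable M (f \<circ> int_iterate M T n)"
  using sq_integrable_funpow[of f "nat n"] mpt.sq_integrable_funpow[OF inverse_mpt, of f "nat (- n)"]
  by (simp add: int_iterate_def comp_def)

text \<open>Shifting both times by one is composition with \<open>T\<close>, which preserves the
  norm; induction in both directions gives every integer shift.\<close>

lemma L2_norm_int_iterate_shift:
  assumes f: "sq_integrable M f"
  shows "L2_norm M (\<lambda>x. f (int_iterate M T (i + k) x) - f (int_iterate M T (j + k) x))
    = L2_norm M (\<lambda>x. f (int_iterate M T i x) - f (int_iterate M T j x))" (is "?D (i + k) (j + k) = ?D i j")
proof -
  have bij: "bij_betw T (space M) (space M)" using invertible by (simp add: invertible_mpt_def)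
  have step: "?D (i + 1) (j + 1) = ?D i j" for i j
  proof -
    have [measurable]: "(\<lambda>x. f (int_iterate M T n x)) \<in> borel_measurable M" for n
      using sq_integrable_int_iterate[OF f, of n] by (simp add: sq_integrable_def comp_def)
    have "?D (i + 1) (j + 1) = L2_norm M (\<lambda>x. f (int_iterate M T i (T x)) - f (int_iterate M T j (T x)))"
      unfolding L2_norm_def by (simp add: int_iterate_add1[OF bij] cong: Bochner_Integration.integral_cong)
    also have "\<dots> = ?D i j"
      using L2_norm_funpow[of "\<lambda>x. f (int_iterate M T i x) - f (int_iterate M T j x)" 1] by simp
    finally show ?thesis .
  qed
  show ?thesis
  proof (induction k rule: int_induct[of _ 0])
    case (step1 k)
    with step[of "i + k" "j + k"] show ?case by (simp add: add.assoc)
  next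
    case (step2 k)
    with step[of "i + (k - 1)" "j + (k - 1)"] show ?case by (simp add: algebra_simps)
  qed simp
qed

text \<open>Complexity yields clusters of forward times only. Since the distance is invariant under
  shifts, \<open>separated_card_le\<close> turns them into a bound for separated sets of arbitrary
  integers.\<close>

lemma bounded_complexity_imp_almost_periodic:
  assumes f: "sq_integrable M f" and bc: "bounded_complexity M T f"
  shows "almost_periodic M T f"
proof -
  interpret L: Metric_space "L2_space M" "L2_dist M" by (rule Metric_space_L2)
  note s = sq_integrable_int_iterate[OF f]
  let ?X = "\<lambda>n. L2_class M (f \<circ> int_iterate M T n)"
  have X: "L2_dist M (?X i) (?X j) = L2_norm M (\<lambda>x. f (int_iterate M T i x) - f (int_iterate M T j x))" for i j
    by (simp add: L2_dist_class[OF s s])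
  have nat: "L2_dist M (?X (int i)) (?X (int j)) = L2_norm M (\<lambda>x. f ((T ^^ i) x) - f ((T ^^ j) x))" for i j
    unfolding X by (simp add: int_iterate_def)
  have "L.mtotally_bounded (range ?X)"
  proof (rule L.mtotally_bounded_separated)
    show "range ?X \<subseteq> L2_space M" using s by (auto simp: L2_class_in_space)
    fix \<epsilon> :: real assume "0 < \<epsilon>"
    then obtain K where K: "\<And>n. \<exists>I\<subseteq>{..<n}. n \<le> K * card I \<and> (\<forall>i\<in>I. \<forall>j\<in>I.
        L2_norm M (\<lambda>x. f ((T ^^ i) x) - f ((T ^^ j) x)) < \<epsilon>)"
      using bounded_complexity_close_iterates[OF f bc] by blast
    have "card S \<le> K" if "finite S" "\<forall>a\<in>S. \<forall>b\<in>S. a \<noteq> b \<longrightarrow> \<epsilon> \<le> L2_dist M (?X a) (?X b)" for S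
    proof (rule separated_card_le[where D = "\<lambda>i j. L2_dist M (?X i) (?X j)"])
      show "\<exists>I\<subseteq>{..<n}. n \<le> K * card I \<and> (\<forall>i\<in>I. \<forall>j\<in>I. L2_dist M (?X (int i)) (?X (int j)) < \<epsilon>)" for n
        using K[of n] by (simp only: nat)
    qed (use that in \<open>auto simp: X L2_norm_int_iterate_shift[OF f]\<close>)
    then show "\<exists>K::nat. \<forall>S. finite S \<longrightarrow> (\<forall>a\<in>S. \<forall>b\<in>S. a \<noteq> b \<longrightarrow> \<epsilon> \<le> L2_dist M (?X a) (?X b)) \<longrightarrow> card S \<le> K"
      by blast
  qed
  then show ?thesis by (simp add: almost_periodic_iff[OF s])
qed

text \<open>Total boundedness passes to the forward orbit with centres inside it, so the net
  consists of natural numbers and powers of \<open>T\<close> alone remain.\<close>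

lemma almost_periodic_net:
  assumes f: "sq_integrable M f" and ap: "almost_periodic M T f" and e: "0 < \<epsilon>"
  obtains J where "finite J"
    "\<And>n. \<exists>s\<in>J. L2_norm M (\<lambda>x. f ((T ^^ n) x) - f ((T ^^ s) x)) < \<epsilon>"
proof -
  interpret L: Metric_space "L2_space M" "L2_dist M" by (rule Metric_space_L2)
  note s = sq_integrable_int_iterate[OF f]
  let ?X = "\<lambda>n. L2_class M (f \<circ> int_iterate M T n)"
  have "L.mtotally_bounded (range ?X)" using ap by (simp add: almost_periodic_iff[OF s])
  then have "L.mtotally_bounded (range (\<lambda>n. ?X (int n)))"
    by (rule L.mtotally_bounded_subset) auto
  then obtain K where K: "finite K" "K \<subseteq> range (\<lambda>n. ?X (int n))"
      "range (\<lambda>n. ?X (int n)) \<subseteq> (\<Union>x\<in>K. L.mball x \<epsilon>)"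
    using e unfolding L.mtotally_bounded_def by meson
  obtain J where J: "finite J" "K = (\<lambda>n. ?X (int n)) ` J"
    using finite_subset_image[OF K(1), of "\<lambda>n. ?X (int n)" UNIV] K(2) by auto
  have "\<exists>s\<in>J. L2_norm M (\<lambda>x. f ((T ^^ n) x) - f ((T ^^ s) x)) < \<epsilon>" for n
  proof -
    have "?X (int n) \<in> (\<Union>x\<in>K. L.mball x \<epsilon>)" using K(3) by blast
    then obtain t where "t \<in> J" "?X (int n) \<in> L.mball (?X (int t)) \<epsilon>" unfolding J(2) by blast
    then have "t \<in> J" "L2_dist M (?X (int n)) (?X (int t)) < \<epsilon>"
      by (simp_all add: L.commute)
    moreover have "L2_dist M (?X (int n)) (?X (int t)) = L2_norm M (\<lambda>x. f ((T ^^ n) x) - f ((T ^^ t) x))"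
      unfolding L2_dist_class[OF s s] by (simp add: int_iterate_def)
    ultimately show ?thesis by auto
  qed
  with J(1) show ?thesis by (rule that)
qed

end

section \<open>Almost periodicity implies mean equicontinuity\<close>

context mpt
begin

text \<open>Makes Birkhoff's theorem available on the product, where \<open>fbar\<close> is a time
  average of \<open>cmod (f x - f y)\<close>.\<close>

lemma mpt_pair: "mpt (M \<Otimes>\<^sub>M M) (map_prod T T)"
proof (intro mpt.intro mpt_axioms.intro)
  interpret PP: pair_prob_space M M by unfold_locales
  show "prob_space (M \<Otimes>\<^sub>M M)" by (rule PP.P.prob_space_axioms)
  show "map_prod T T \<in> measurable (M \<Otimes>\<^sub>M M) (M \<Otimes>\<^sub>M M)"
    unfolding map_prod_def case_prod_beta by measurable
  have "prob_space (distr M M T)" by (simp add: T_distr prob_space_axioms)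
  then have "distr M M T \<Otimes>\<^sub>M distr M M T = distr (M \<Otimes>\<^sub>M M) (M \<Otimes>\<^sub>M M) (\<lambda>(x, y). (T x, T y))"
    by (intro pair_measure_distr) (auto intro: prob_space_imp_sigma_finite)
  then show "distr (M \<Otimes>\<^sub>M M) (M \<Otimes>\<^sub>M M) (map_prod T T) = M \<Otimes>\<^sub>M M"
    by (simp add: T_distr map_prod_def)
qed

lemma funpow_map_prod: "(map_prod T T ^^ n) p = ((T ^^ n) (fst p), (T ^^ n) (snd p))"
  by (induction n) (simp_all add: map_prod_def case_prod_beta)

text \<open>Tonelli's theorem in both orders. The marginals are bounded by 1 rather than equal to it
  because a coupling confined to finitely many cells loses mass.\<close>

lemma nn_integral_marginals:
  assumes \<phi> [measurable]: "\<phi> \<in> borel_measurable (M \<Otimes>\<^sub>M M)" and u [measurable]: "u \<in> borel_measurable M"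
    and le: "\<And>x. x \<in> space M \<Longrightarrow> (\<integral>\<^sup>+y. \<phi> (x, y) \<partial>M) \<le> 1"
      "\<And>y. y \<in> space M \<Longrightarrow> (\<integral>\<^sup>+x. \<phi> (x, y) \<partial>M) \<le> 1"
  shows "(\<integral>\<^sup>+p. \<phi> p * u (fst p) \<partial>(M \<Otimes>\<^sub>M M)) \<le> (\<integral>\<^sup>+x. u x \<partial>M)"
    and "(\<integral>\<^sup>+p. \<phi> p * u (snd p) \<partial>(M \<Otimes>\<^sub>M M)) \<le> (\<integral>\<^sup>+x. u x \<partial>M)"
proof -
  interpret PP: pair_sigma_finite M M by unfold_locales
  have "(\<integral>\<^sup>+p. \<phi> p * u (fst p) \<partial>(M \<Otimes>\<^sub>M M)) = (\<integral>\<^sup>+x. \<integral>\<^sup>+y. \<phi> (x, y) * u x \<partial>M \<partial>M)"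
    by (subst nn_integral_fst[symmetric]) simp_all
  also have "\<dots> = (\<integral>\<^sup>+x. (\<integral>\<^sup>+y. \<phi> (x, y) \<partial>M) * u x \<partial>M)"
    by (intro nn_integral_cong nn_integral_multc) simp
  also have "\<dots> \<le> (\<integral>\<^sup>+x. 1 * u x \<partial>M)"
    by (intro nn_integral_mono mult_right_mono le) simp_all
  finally show "(\<integral>\<^sup>+p. \<phi> p * u (fst p) \<partial>(M \<Otimes>\<^sub>M M)) \<le> (\<integral>\<^sup>+x. u x \<partial>M)" by simp
  have "(\<integral>\<^sup>+p. \<phi> p * u (snd p) \<partial>(M \<Otimes>\<^sub>M M)) = (\<integral>\<^sup>+y. \<integral>\<^sup>+x. \<phi> (x, y) * u y \<partial>M \<partial>M)"
    by (subst PP.nn_integral_snd[symmetric]) simp_all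
  also have "\<dots> = (\<integral>\<^sup>+y. (\<integral>\<^sup>+x. \<phi> (x, y) \<partial>M) * u y \<partial>M)"
    by (intro nn_integral_cong nn_integral_multc) simp
  also have "\<dots> \<le> (\<integral>\<^sup>+y. 1 * u y \<partial>M)"
    by (intro nn_integral_mono mult_right_mono le) simp_all
  finally show "(\<integral>\<^sup>+p. \<phi> p * u (snd p) \<partial>(M \<Otimes>\<^sub>M M)) \<le> (\<integral>\<^sup>+x. u x \<partial>M)" by simp
qed

lemma fbar_pair_measurable [measurable]:
  assumes [measurable]: "f \<in> borel_measurable M"
  shows "(\<lambda>p. fbar T f n (fst p) (snd p)) \<in> borel_measurable (M \<Otimes>\<^sub>M M)"
  unfolding fbar_def by measurable

text \<open>Fatou's lemma controls lower limits, whereas mean equicontinuity concerns upper limits;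
  Birkhoff's theorem on the product bridges the two.\<close>

lemma fbar_limit:
  assumes f: "sq_integrable M f"
  shows "AE p in M \<Otimes>\<^sub>M M. limsup (\<lambda>n. ereal (fbar T f n (fst p) (snd p)))
    \<le> liminf (\<lambda>n. ereal (fbar T f n (fst p) (snd p)))"
proof -
  interpret P: mpt "M \<Otimes>\<^sub>M M" "map_prod T T" by (rule mpt_pair)
  have [measurable]: "f \<in> borel_measurable M" using f by (simp add: sq_integrable_def)
  have fin: "(\<integral>\<^sup>+x. ennreal (cmod (f x)) \<partial>M) < \<infinity>"
    using L1_le_L2_norm(1)[OF f] by (simp add: integrable_iff_bounded)
  have "integrable (M \<Otimes>\<^sub>M M) (\<lambda>p. cmod (f (fst p) - f (snd p)))"
  proof (rule integrableI_bounded)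
    have "(\<integral>\<^sup>+p. ennreal (norm (cmod (f (fst p) - f (snd p)))) \<partial>(M \<Otimes>\<^sub>M M))
        \<le> (\<integral>\<^sup>+p. ennreal (cmod (f (fst p))) + ennreal (cmod (f (snd p))) \<partial>(M \<Otimes>\<^sub>M M))"
      by (intro nn_integral_mono) (simp add: norm_triangle_ineq4 flip: ennreal_plus)
    also have "\<dots> = (\<integral>\<^sup>+p. ennreal (cmod (f (fst p))) \<partial>(M \<Otimes>\<^sub>M M)) + (\<integral>\<^sup>+p. ennreal (cmod (f (snd p))) \<partial>(M \<Otimes>\<^sub>M M))"
      by (rule nn_integral_add) simp_all
    also have "\<dots> \<le> (\<integral>\<^sup>+x. ennreal (cmod (f x)) \<partial>M) + (\<integral>\<^sup>+x. ennreal (cmod (f x)) \<partial>M)"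
      using nn_integral_marginals[of "\<lambda>_. 1" "\<lambda>x. ennreal (cmod (f x))"]
      by (intro add_mono) (simp_all add: emeasure_space_1)
    also have "\<dots> < \<infinity>" using fin by simp
    finally show "(\<integral>\<^sup>+p. ennreal (norm (cmod (f (fst p) - f (snd p)))) \<partial>(M \<Otimes>\<^sub>M M)) < \<infinity>" .
  qed simp
  from P.birkhoff[OF this] show ?thesis
    by (simp add: P.average_def[abs_def] fbar_def funpow_map_prod)
qed

text \<open>A function cannot exceed its mean over \<open>A\<close> at every point of
  \<open>A\<close>. It is used to choose the centre of a cell.\<close>

lemma exists_le_mean:
  assumes A [measurable]: "A \<in> sets M" and pos: "0 < measure M A"
    and w [measurable]: "w \<in> borel_measurable M"
  shows "\<exists>x\<in>A. w x \<le> ennreal (1 / measure M A) * (\<integral>\<^sup>+x. indicator A x * w x \<partial>M)"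
proof (rule ccontr)
  define b where "b = ennreal (1 / measure M A) * (\<integral>\<^sup>+x. indicator A x * w x \<partial>M)"
  assume "\<not> ?thesis"
  then have less: "b < w x" if "x \<in> A" for x using that by (auto simp: b_def not_le)
  have "A \<noteq> {}" using pos by auto
  \<comment> \<open>Strict comparison of integrals requires the smaller one to be finite.\<close>
  then have fin: "b < \<infinity>" using less by (metis ex_in_conv infinity_ennreal_def order_less_le_trans top_greatest)
  have "(\<integral>\<^sup>+x. b * indicator A x \<partial>M) = b * ennreal (measure M A)"
    by (subst nn_integral_cmult_indicator[OF A]) (simp only: emeasure_eq_measure)
  also have "\<dots> = (ennreal (1 / measure M A) * ennreal (measure M A)) * (\<integral>\<^sup>+x. indicator A x * w x \<partial>M)"
    by (simp add: b_def ac_simps)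
  also have "ennreal (1 / measure M A) * ennreal (measure M A) = 1"
    using pos by (simp flip: ennreal_mult)
  finally have eq: "(\<integral>\<^sup>+x. b * indicator A x \<partial>M) = (\<integral>\<^sup>+x. indicator A x * w x \<partial>M)" by simp
  have "(\<integral>\<^sup>+x. b * indicator A x \<partial>M) < (\<integral>\<^sup>+x. indicator A x * w x \<partial>M)"
  proof (rule nn_integral_less)
    show "(\<integral>\<^sup>+x. b * indicator A x \<partial>M) \<noteq> \<infinity>"
      using fin by (subst nn_integral_cmult_indicator)
        (auto simp: emeasure_eq_measure ennreal_mult_eq_top_iff)
    show "AE x in M. b * indicator A x \<le> indicator A x * w x"
      using less by (auto simp: indicator_def less_imp_le)
    show "\<not> (AE x in M. indicator A x * w x \<le> b * indicator A x)"
    proof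
      assume "AE x in M. indicator A x * w x \<le> b * indicator A x"
      then have "AE x in M. x \<notin> A"
        by eventually_elim (use less in \<open>force simp: indicator_def split: if_splits\<close>)
      then have "emeasure M A = 0"
        using AE_iff_measurable[OF A, of "\<lambda>x. x \<notin> A"] sets.sets_into_space[OF A] by auto
      with pos show False by (simp add: emeasure_eq_measure)
    qed
  qed simp_all
  with eq show False by simp
qed

text \<open>The density couples \<open>x\<close> with an independent random point \<open>y\<close> of its cell; null cells get the
  weight \<open>1 / 0 = 0\<close>.\<close>

definition cell_coupling :: "('a \<Rightarrow> nat) \<Rightarrow> nat \<Rightarrow> 'a \<times> 'a \<Rightarrow> ennreal" where
  "cell_coupling \<kappa> m p = (\<Sum>k<m. ennreal (1 / measure M (\<kappa> -` {k} \<inter> space M)) *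
     (indicator (\<kappa> -` {k} \<inter> space M) (fst p) * indicator (\<kappa> -` {k} \<inter> space M) (snd p)))"

lemma cell_coupling_measurable [measurable]:
  assumes [measurable]: "\<kappa> \<in> measurable M (count_space UNIV)"
  shows "cell_coupling \<kappa> m \<in> borel_measurable (M \<Otimes>\<^sub>M M)"
proof -
  have [measurable]: "\<kappa> -` {k} \<inter> space M \<in> sets M" for k by (rule measurable_sets[OF assms]) simp
  show ?thesis unfolding cell_coupling_def[abs_def] by measurable
qed

lemma cell_coupling_commute: "cell_coupling \<kappa> m (x, y) = cell_coupling \<kappa> m (y, x)"
  by (simp add: cell_coupling_def mult.commute)

lemma cell_coupling_nonzero:
  "cell_coupling \<kappa> m (x, y) \<noteq> 0 \<Longrightarrow> \<kappa> x = \<kappa> y"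
  by (auto simp: cell_coupling_def sum_nonneg_eq_0_iff indicator_def split: if_splits)

text \<open>Only the cell of \<open>x\<close> contributes, and it gives its measure divided by
  itself, or 0 if it is null.\<close>

lemma cell_coupling_marginal:
  assumes [measurable]: "\<kappa> \<in> measurable M (count_space UNIV)" and x: "x \<in> space M"
  shows "(\<integral>\<^sup>+y. cell_coupling \<kappa> m (x, y) \<partial>M) \<le> 1"
proof -
  let ?A = "\<lambda>k. \<kappa> -` {k} \<inter> space M"
  have A [measurable]: "?A k \<in> sets M" for k by (rule measurable_sets[OF assms(1)]) simp
  have "(\<integral>\<^sup>+y. cell_coupling \<kappa> m (x, y) \<partial>M)
      = (\<Sum>k<m. \<integral>\<^sup>+y. (ennreal (1 / measure M (?A k)) * indicator (?A k) x) * indicator (?A k) y \<partial>M)"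
    unfolding cell_coupling_def by (subst nn_integral_sum[symmetric]) (simp_all add: mult.assoc)
  also have "\<dots> = (\<Sum>k<m. indicator (?A k) x * (ennreal (1 / measure M (?A k)) * ennreal (measure M (?A k))))"
    by (intro sum.cong refl, subst nn_integral_cmult_indicator[OF A]) (simp add: emeasure_eq_measure ac_simps)
  also have "\<dots> \<le> (\<Sum>k<m. if k = \<kappa> x then 1 else 0)"
    by (intro sum_mono) (auto simp: indicator_def simp flip: ennreal_mult)
  also have "\<dots> \<le> 1" by simp
  finally show ?thesis .
qed

text \<open>For each time \<open>i\<close> choose \<open>s\<close> in \<open>J\<close> with close
  iterates. On the support of the coupling both points share a cell, so passing to time
  \<open>s\<close> and back costs \<eta> plus one error term per point. The marginals bound each
  error by an L^1 norm below \<delta>; then average over \<open>i\<close>.\<close>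

lemma fbar_coupling_le:
  assumes f: "sq_integrable M f" and [measurable]: "\<kappa> \<in> measurable M (count_space UNIV)"
    and "0 < \<eta>" "0 < \<delta>"
    and cell: "\<And>x y s. \<kappa> x = \<kappa> y \<Longrightarrow> s \<in> J \<Longrightarrow> cmod (f ((T ^^ s) x) - f ((T ^^ s) y)) < \<eta>"
    and net: "\<And>n. \<exists>s\<in>J. L2_norm M (\<lambda>x. f ((T ^^ n) x) - f ((T ^^ s) x)) < \<delta>"
  shows "(\<integral>\<^sup>+p. cell_coupling \<kappa> m p * ennreal (fbar T f n (fst p) (snd p)) \<partial>(M \<Otimes>\<^sub>M M)) \<le> ennreal (\<eta> + 2 * \<delta>)"
proof -
  let ?\<phi> = "cell_coupling \<kappa> m" and ?P = "M \<Otimes>\<^sub>M M"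
  let ?F = "\<lambda>i p. cmod (f ((T ^^ i) (fst p)) - f ((T ^^ i) (snd p)))"
  have [measurable]: "f \<in> borel_measurable M" using f by (simp add: sq_integrable_def)
  have marg: "(\<integral>\<^sup>+y. ?\<phi> (x, y) \<partial>M) \<le> 1" "(\<integral>\<^sup>+y. ?\<phi> (y, x) \<partial>M) \<le> 1" if "x \<in> space M" for x
    using cell_coupling_marginal[of \<kappa> x m] that by (simp_all add: cell_coupling_commute[of \<kappa> m _ x])
  have F: "(\<integral>\<^sup>+p. ?\<phi> p * ennreal (?F i p) \<partial>?P) \<le> ennreal (\<eta> + 2 * \<delta>)" for i
  proof -
    obtain s where s: "s \<in> J" "L2_norm M (\<lambda>x. f ((T ^^ i) x) - f ((T ^^ s) x)) < \<delta>" using net by blast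
    define d where "d x = ennreal (cmod (f ((T ^^ i) x) - f ((T ^^ s) x)))" for x
    have [measurable]: "d \<in> borel_measurable M" unfolding d_def[abs_def] by measurable
    have sq: "sq_integrable M (\<lambda>x. f ((T ^^ i) x) - f ((T ^^ s) x))"
      by (intro sq_integrable_diff sq_integrable_funpow f)
    have "(\<integral>\<^sup>+x. d x \<partial>M) = ennreal (\<integral>x. cmod (f ((T ^^ i) x) - f ((T ^^ s) x)) \<partial>M)"
      unfolding d_def by (intro nn_integral_eq_integral L1_le_L2_norm[OF sq]) simp
    also have "\<dots> \<le> ennreal \<delta>"
      using L1_le_L2_norm(2)[OF sq] s(2) by (intro ennreal_leI) linarith
    finally have d: "(\<integral>\<^sup>+x. d x \<partial>M) \<le> ennreal \<delta>" .
    have "(\<integral>\<^sup>+p. ?\<phi> p * ennreal (?F i p) \<partial>?P)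
        \<le> (\<integral>\<^sup>+p. ?\<phi> p * ennreal \<eta> + ?\<phi> p * d (fst p) + ?\<phi> p * d (snd p) \<partial>?P)"
    proof (rule nn_integral_mono)
      fix p
      show "?\<phi> p * ennreal (?F i p) \<le> ?\<phi> p * ennreal \<eta> + ?\<phi> p * d (fst p) + ?\<phi> p * d (snd p)"
      proof (cases "?\<phi> p = 0")
        case False
        then have "\<kappa> (fst p) = \<kappa> (snd p)" using cell_coupling_nonzero[of \<kappa> m "fst p" "snd p"] by simp
        from cell[OF this s(1)]
        have "?F i p \<le> \<eta> + cmod (f ((T ^^ i) (fst p)) - f ((T ^^ s) (fst p)))
            + cmod (f ((T ^^ i) (snd p)) - f ((T ^^ s) (snd p)))"
          unfolding dist_norm[symmetric] by metric
        then have "ennreal (?F i p) \<le> ennreal \<eta> + d (fst p) + d (snd p)"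
          using \<open>0 < \<eta>\<close> unfolding d_def by (subst (asm) ennreal_le_iff[symmetric]) (auto simp: ennreal_plus)
        then have "?\<phi> p * ennreal (?F i p) \<le> ?\<phi> p * (ennreal \<eta> + d (fst p) + d (snd p))"
          by (rule mult_left_mono) simp
        then show ?thesis by (simp add: distrib_left)
      qed simp
    qed
    also have "\<dots> = (\<integral>\<^sup>+p. ?\<phi> p * ennreal \<eta> \<partial>?P) + (\<integral>\<^sup>+p. ?\<phi> p * d (fst p) \<partial>?P) + (\<integral>\<^sup>+p. ?\<phi> p * d (snd p) \<partial>?P)"
      by (simp add: nn_integral_add)
    also have "\<dots> \<le> (\<integral>\<^sup>+x. ennreal \<eta> \<partial>M) + (\<integral>\<^sup>+x. d x \<partial>M) + (\<integral>\<^sup>+x. d x \<partial>M)"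
      using nn_integral_marginals[of ?\<phi> "\<lambda>_. ennreal \<eta>"] nn_integral_marginals[of ?\<phi> d] marg
      by (intro add_mono) auto
    also have "\<dots> \<le> ennreal \<eta> + ennreal \<delta> + ennreal \<delta>"
      using d by (intro add_mono) (simp_all add: emeasure_space_1)
    also have "\<dots> = ennreal (\<eta> + 2 * \<delta>)"
      using \<open>0 < \<eta>\<close> \<open>0 < \<delta>\<close> by (simp flip: ennreal_plus)
    finally show ?thesis .
  qed
  show ?thesis
  proof (cases "n = 0")
    case False
    have "(\<integral>\<^sup>+p. ?\<phi> p * ennreal (fbar T f n (fst p) (snd p)) \<partial>?P)
        = (\<integral>\<^sup>+p. ennreal (1 / real n) * (\<Sum>i<n. ?\<phi> p * ennreal (?F i p)) \<partial>?P)"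
    proof (rule nn_integral_cong)
      fix p
      have "ennreal (fbar T f n (fst p) (snd p)) = ennreal (1 / real n) * (\<Sum>i<n. ennreal (?F i p))"
        unfolding fbar_def by (subst ennreal_mult) (simp_all add: sum_nonneg sum_ennreal)
      then show "?\<phi> p * ennreal (fbar T f n (fst p) (snd p))
          = ennreal (1 / real n) * (\<Sum>i<n. ?\<phi> p * ennreal (?F i p))"
        by (simp only: sum_distrib_left[symmetric] mult.left_commute)
    qed
    also have "\<dots> = ennreal (1 / real n) * (\<Sum>i<n. \<integral>\<^sup>+p. ?\<phi> p * ennreal (?F i p) \<partial>?P)"
      by (simp add: nn_integral_cmult nn_integral_sum)
    also have "\<dots> \<le> ennreal (1 / real n) * (\<Sum>i<n. ennreal (\<eta> + 2 * \<delta>))"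
      by (intro mult_left_mono sum_mono F) simp
    also have "\<dots> = (ennreal (1 / real n) * ennreal (real n)) * ennreal (\<eta> + 2 * \<delta>)"
      by (simp only: sum_constant card_lessThan ennreal_of_nat_eq_real_of_nat mult.assoc)
    also have "ennreal (1 / real n) * ennreal (real n) = 1"
      using False by (simp flip: ennreal_mult)
    finally show ?thesis by simp
  qed (simp add: fbar_def)
qed

text \<open>Markov's inequality in the limit: almost everywhere on \<open>W\<close> the value \<tau>
  is at most the lower limit, by \<open>fbar_limit\<close>, and Fatou's lemma applies the uniform
  bound of \<open>fbar_coupling_le\<close>.\<close>

lemma limsup_coupling_le:
  assumes f: "sq_integrable M f" and [measurable]: "\<kappa> \<in> measurable M (count_space UNIV)"
    and "0 < \<eta>" "0 < \<delta>" "0 < \<tau>"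
    and cell: "\<And>x y s. \<kappa> x = \<kappa> y \<Longrightarrow> s \<in> J \<Longrightarrow> cmod (f ((T ^^ s) x) - f ((T ^^ s) y)) < \<eta>"
    and net: "\<And>n. \<exists>s\<in>J. L2_norm M (\<lambda>x. f ((T ^^ n) x) - f ((T ^^ s) x)) < \<delta>"
    and W: "W = {p \<in> space (M \<Otimes>\<^sub>M M). ereal \<tau> \<le> limsup (\<lambda>n. ereal (fbar T f n (fst p) (snd p)))}"
  shows "ennreal \<tau> * (\<integral>\<^sup>+p. cell_coupling \<kappa> m p * indicator W p \<partial>(M \<Otimes>\<^sub>M M)) \<le> ennreal (\<eta> + 2 * \<delta>)"
proof -
  let ?\<phi> = "cell_coupling \<kappa> m" and ?P = "M \<Otimes>\<^sub>M M"
  let ?b = "\<lambda>n p. fbar T f n (fst p) (snd p)"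
  have [measurable]: "f \<in> borel_measurable M" using f by (simp add: sq_integrable_def)
  have [measurable]: "W \<in> sets ?P" unfolding W by measurable
  \<comment> \<open>Absorbing the weight into the measure keeps it out of the lower limit when
    Fatou's lemma is applied.\<close>
  let ?N = "density ?P ?\<phi>"
  have "ennreal \<tau> * (\<integral>\<^sup>+p. ?\<phi> p * indicator W p \<partial>?P) = (\<integral>\<^sup>+p. ennreal \<tau> * indicator W p \<partial>?N)"
    by (subst nn_integral_density, simp_all add: mult.left_commute[of _ "ennreal \<tau>"] nn_integral_cmult)
  also have "\<dots> \<le> (\<integral>\<^sup>+p. liminf (\<lambda>n. ennreal (?b n p)) \<partial>?N)"
  proof (rule nn_integral_mono_AE)
    have "AE p in ?P. ennreal \<tau> * indicator W p \<le> liminf (\<lambda>n. ennreal (?b n p))"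
      using fbar_limit[OF f]
    proof eventually_elim
      case (elim p)
      show ?case
      proof (cases "p \<in> W")
        case True
        then have le: "ereal \<tau> \<le> liminf (\<lambda>n. ereal (?b n p))"
          using elim by (auto simp: W intro: order_trans)
        have "ennreal \<tau> \<le> liminf (\<lambda>n. ennreal (?b n p))"
          unfolding le_Liminf_iff
        proof (intro allI impI)
          fix y assume "y < ennreal \<tau>"
          then obtain r where r: "y = ennreal r" "0 \<le> r" "r < \<tau>"
            by (cases y) (auto simp: ennreal_less_iff)
          then have "eventually (\<lambda>n. ereal r < ereal (?b n p)) sequentially"
            using r by (intro less_LiminfD order_less_le_trans[OF _ le]) simp
          then show "eventually (\<lambda>n. y < ennreal (?b n p)) sequentially"
            by eventually_elim (use r in \<open>simp add: ennreal_less_iff\<close>)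
        qed
        with True show ?thesis by simp
      qed simp
    qed
    then show "AE p in ?N. ennreal \<tau> * indicator W p \<le> liminf (\<lambda>n. ennreal (?b n p))"
      by (subst AE_density) auto
  qed
  also have "\<dots> \<le> liminf (\<lambda>n. \<integral>\<^sup>+p. ennreal (?b n p) \<partial>?N)"
    by (rule nn_integral_liminf) simp
  also have "\<dots> \<le> liminf (\<lambda>n. ennreal (\<eta> + 2 * \<delta>))"
    using fbar_coupling_le[OF f assms(2-4) cell net, of m]
    by (intro Liminf_mono always_eventually allI) (simp add: nn_integral_density)
  finally show ?thesis by (simp add: Liminf_const)
qed

lemma fbar_triangle: "fbar T f n x y \<le> fbar T f n z x + fbar T f n z y"
proof -
  have "cmod (f ((T ^^ i) x) - f ((T ^^ i) y))
      \<le> cmod (f ((T ^^ i) z) - f ((T ^^ i) x)) + cmod (f ((T ^^ i) z) - f ((T ^^ i) y))" for i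
    unfolding dist_norm[symmetric] by metric
  then have "(\<Sum>i<n. cmod (f ((T ^^ i) x) - f ((T ^^ i) y)))
      \<le> (\<Sum>i<n. cmod (f ((T ^^ i) z) - f ((T ^^ i) x))) + (\<Sum>i<n. cmod (f ((T ^^ i) z) - f ((T ^^ i) y)))"
    by (subst sum.distrib[symmetric]) (rule sum_mono)
  from mult_left_mono[OF this, of "1 / real n"] show ?thesis
    by (simp add: fbar_def distrib_left add_divide_distrib)
qed

text \<open>\<open>W\<close> is the set of bad pairs. Each cell of positive measure receives a
  centre \<open>c k\<close> with few bad partners; removing these partners \<open>Z k\<close> leaves
  sets on which two points are compared through the centre. The coupling bound controls the total
  mass removed.\<close>

lemma net_imp_mean_equicontinuous:
  assumes f: "sq_integrable M f"
    and net: "\<And>\<epsilon>. 0 < \<epsilon> \<Longrightarrow> \<exists>J. finite J \<and> (\<forall>n. \<exists>s\<in>J. L2_norm M (\<lambda>x. f ((T ^^ n) x) - f ((T ^^ s) x)) < \<epsilon>)"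
  shows "mean_equicontinuous M T f"
  unfolding mean_equicontinuous_def
proof (intro allI impI)
  fix \<epsilon> :: real assume e: "0 < \<epsilon>"
  have fm [measurable]: "f \<in> borel_measurable M" using f by (simp add: sq_integrable_def)
  \<comment> \<open>Then \<open>3 * \<eta>\<close> is the square of \<open>\<epsilon> / 4\<close>;
    with threshold \<open>\<epsilon> / 4\<close> the bad mass is at most
    \<open>\<epsilon> / 4\<close>.\<close>
  define \<eta> where "\<eta> = \<epsilon>\<^sup>2 / 48"
  have \<eta>: "0 < \<eta>" using e by (simp add: \<eta>_def)
  obtain J where J: "finite J" "\<And>n. \<exists>s\<in>J. L2_norm M (\<lambda>x. f ((T ^^ n) x) - f ((T ^^ s) x)) < \<eta>"
    using net[OF \<eta>] by blast
  obtain \<kappa> :: "'a \<Rightarrow> nat" where k [measurable]: "\<kappa> \<in> measurable M (count_space UNIV)"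
    and cell: "\<And>x y s. \<kappa> x = \<kappa> y \<Longrightarrow> s \<in> J \<Longrightarrow> cmod (f ((T ^^ s) x) - f ((T ^^ s) y)) < \<eta>"
    using finite_orbit_cells[OF fm J(1) \<eta>] by blast
  have e2: "0 < \<epsilon> / 2" using e by simp
  obtain m where m: "measure M {x \<in> space M. \<kappa> x < m} > 1 - \<epsilon> / 2"
    using finitely_many_cells[OF k e2] by blast
  define A where "A k = \<kappa> -` {k} \<inter> space M" for k
  have [measurable]: "A k \<in> sets M" for k unfolding A_def by measurable
  define W where "W = {p \<in> space (M \<Otimes>\<^sub>M M). ereal (\<epsilon> / 4) \<le> limsup (\<lambda>n. ereal (fbar T f n (fst p) (snd p)))}"
  have [measurable]: "W \<in> sets (M \<Otimes>\<^sub>M M)" unfolding W_def by measurable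
  define w where "w k x = (\<integral>\<^sup>+y. indicator (A k) y * indicator W (x, y) \<partial>M)" for k x
  have [measurable]: "w k \<in> borel_measurable M" for k unfolding w_def[abs_def] by measurable
  \<comment> \<open>\<open>b k\<close> has two readings: the coupled mass of \<open>W\<close> in
    cell \<open>k\<close>, whose sum is controlled, and the mean of \<open>w k\<close> over the
    cell, which some centre does not exceed.\<close>
  define b where "b k = ennreal (1 / measure M (A k)) * (\<integral>\<^sup>+x. indicator (A k) x * w k x \<partial>M)" for k
  have e4: "0 < \<epsilon> / 4" using e by simp
  have b: "(\<integral>\<^sup>+p. cell_coupling \<kappa> m p * indicator W p \<partial>(M \<Otimes>\<^sub>M M)) = (\<Sum>k<m. b k)"
  proof -
    have "(\<integral>\<^sup>+p. cell_coupling \<kappa> m p * indicator W p \<partial>(M \<Otimes>\<^sub>M M))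
        = (\<Sum>k<m. ennreal (1 / measure M (A k)) *
            (\<integral>\<^sup>+p. indicator (A k) (fst p) * (indicator (A k) (snd p) * indicator W p) \<partial>(M \<Otimes>\<^sub>M M)))"
      unfolding cell_coupling_def A_def[symmetric]
      by (simp add: sum_distrib_right nn_integral_sum nn_integral_cmult mult.assoc)
    moreover have "(\<integral>\<^sup>+p. indicator (A k) (fst p) * (indicator (A k) (snd p) * indicator W p) \<partial>(M \<Otimes>\<^sub>M M))
        = (\<integral>\<^sup>+x. indicator (A k) x * w k x \<partial>M)" for k
      unfolding w_def
      by (subst nn_integral_fst[symmetric], measurable, intro nn_integral_cong)
        (subst nn_integral_cmult[symmetric], simp_all)
    ultimately show ?thesis by (simp only: b_def)
  qed
  have "ennreal (\<epsilon> / 4) * (\<Sum>k<m. b k) \<le> ennreal (\<eta> + 2 * \<eta>)"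
    using limsup_coupling_le[OF f k \<eta> \<eta> e4 cell J(2) W_def, of m] by (simp only: b)
  also have "\<eta> + 2 * \<eta> = \<epsilon> / 4 * (\<epsilon> / 4)" by (simp add: \<eta>_def power2_eq_square)
  also have "ennreal \<dots> = ennreal (\<epsilon> / 4) * ennreal (\<epsilon> / 4)"
    using e by (intro ennreal_mult) simp_all
  finally have sum_b: "(\<Sum>k<m. b k) \<le> ennreal (\<epsilon> / 4)"
    using e by (simp add: ennreal_mult_le_mult_iff)
  have "\<exists>x\<in>A k. w k x \<le> b k" if "0 < measure M (A k)" for k
    unfolding b_def by (rule exists_le_mean) (use that in simp_all)
  then obtain c where c: "\<And>k. 0 < measure M (A k) \<Longrightarrow> c k \<in> A k \<and> w k (c k) \<le> b k" by metis
  \<comment> \<open>Null cells are discarded whole, so every point that survives lies in a cell with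
    a centre.\<close>
  define Z where "Z k = (if 0 < measure M (A k) then {y \<in> A k. (c k, y) \<in> W} else A k)" for k
  have cs: "c k \<in> space M" if "0 < measure M (A k)" for k using c[OF that] by (auto simp: A_def)
  have Zm [measurable]: "Z k \<in> sets M" for k
  proof (cases "0 < measure M (A k)")
    case True
    have "Z k = A k \<inter> (Pair (c k) -` W)" using True by (auto simp: Z_def)
    then show ?thesis by (simp add: sets_Pair1)
  qed (simp add: Z_def)
  have Zb: "emeasure M (Z k) \<le> b k" for k
  proof (cases "0 < measure M (A k)")
    case True
    have "emeasure M (Z k) = (\<integral>\<^sup>+y. indicator (Z k) y \<partial>M)" by simp
    also have "\<dots> = w k (c k)"
      unfolding w_def using True by (intro nn_integral_cong) (auto simp: Z_def indicator_def)
    finally show ?thesis using c[OF True] by simp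
  next
    case False
    then have "measure M (A k) = 0" by (simp add: zero_less_measure_iff)
    then show ?thesis by (simp add: Z_def emeasure_eq_measure)
  qed
  have "emeasure M (\<Union>k<m. Z k) \<le> (\<Sum>k<m. emeasure M (Z k))"
    by (rule emeasure_subadditive_finite) auto
  also have "\<dots> \<le> (\<Sum>k<m. b k)" by (intro sum_mono Zb)
  also note sum_b
  finally have Z: "measure M (\<Union>k<m. Z k) \<le> \<epsilon> / 4"
    using e by (simp add: emeasure_eq_measure)
  \<comment> \<open>Cells are numbered from 0, the sets in \<open>mean_equicontinuous\<close> from
    1.\<close>
  define B where "B i = A (i - 1) - Z (i - 1)" for i
  have "measure M {x \<in> space M. \<kappa> x < m} \<le> measure M ((\<Union>i\<in>{1..m}. B i) \<union> (\<Union>k<m. Z k))"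
  proof (rule finite_measure_mono)
    show "{x \<in> space M. \<kappa> x < m} \<subseteq> (\<Union>i\<in>{1..m}. B i) \<union> (\<Union>k<m. Z k)"
    proof
      fix x assume x: "x \<in> {x \<in> space M. \<kappa> x < m}"
      show "x \<in> (\<Union>i\<in>{1..m}. B i) \<union> (\<Union>k<m. Z k)"
      proof (cases "x \<in> Z (\<kappa> x)")
        case False
        with x have "x \<in> B (Suc (\<kappa> x))" "Suc (\<kappa> x) \<in> {1..m}" by (auto simp: B_def A_def)
        then show ?thesis by blast
      qed (use x in auto)
    qed
  qed (auto simp: B_def)
  also have "\<dots> \<le> measure M (\<Union>i\<in>{1..m}. B i) + measure M (\<Union>k<m. Z k)"
    by (rule measure_Un_le) (auto simp: B_def)
  finally have "measure M (\<Union>i\<in>{1..m}. B i) > 1 - \<epsilon>" using m Z e by linarith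
  moreover have "limsup (\<lambda>n. ereal (fbar T f n x y)) < ereal \<epsilon>" if "x \<in> B i" "y \<in> B i" for i x y
  proof -
    let ?k = "i - 1"
    have pos: "0 < measure M (A ?k)" using that(1) by (auto simp: B_def Z_def split: if_splits)
    have near: "eventually (\<lambda>n. fbar T f n (c ?k) z < \<epsilon> / 4) sequentially" if "z \<in> B i" for z
    proof -
      have "z \<in> space M" "(c ?k, z) \<notin> W" using that pos by (auto simp: B_def Z_def A_def)
      then have "limsup (\<lambda>n. ereal (fbar T f n (c ?k) z)) < ereal (\<epsilon> / 4)"
        using cs[OF pos] by (auto simp: W_def space_pair_measure)
      from Limsup_lessD[OF this] show ?thesis by simp
    qed
    \<comment> \<open>Both points are eventually within \<open>\<epsilon> / 4\<close> of the centre;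
      the slack up to \<epsilon> makes the final bound on the upper limit strict.\<close>
    have "eventually (\<lambda>n. ereal (fbar T f n x y) \<le> ereal (\<epsilon> / 2)) sequentially"
      using near[OF that(1)] near[OF that(2)]
    proof eventually_elim
      case (elim n)
      with fbar_triangle[of f n x y "c ?k"] show ?case by simp
    qed
    then have "limsup (\<lambda>n. ereal (fbar T f n x y)) \<le> ereal (\<epsilon> / 2)" by (rule Limsup_bounded)
    also have "\<dots> < ereal \<epsilon>" using e by simp
    finally show ?thesis .
  qed
  moreover have "B i \<in> sets M" for i by (simp add: B_def)
  ultimately show "\<exists>(k::nat) A. (\<forall>i\<in>{1..k}. A i \<in> sets M) \<and> measure M (\<Union>i\<in>{1..k}. A i) > 1 - \<epsilon> \<and>
      (\<forall>i\<in>{1..k}. \<forall>x\<in>A i. \<forall>y\<in>A i. limsup (\<lambda>n. ereal (fbar T f n x y)) < ereal \<epsilon>)"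
    by (intro exI[of _ m] exI[of _ B]) blast
qed

end

theorem corollary5p3:
  fixes M :: "'a measure" and T :: "'a \<Rightarrow> 'a" and f :: "'a \<Rightarrow> complex"
  assumes "Lebesgue_space M"
    and "invertible_mpt M T"
    and "sq_integrable M f"
  shows "(almost_periodic M T f \<longleftrightarrow> mean_equicontinuous M T f) \<and>
         (mean_equicontinuous M T f \<longleftrightarrow> bounded_complexity M T f)"
proof -
  interpret prob_space M using assms(1) by (simp add: Lebesgue_space_def)
  interpret invertible_mpt_space M T
    by unfold_locales (use assms(2) in \<open>auto simp: invertible_mpt_def\<close>)
  have "almost_periodic M T f \<Longrightarrow> mean_equicontinuous M T f"
    by (rule net_imp_mean_equicontinuous[OF assms(3)]) (metis almost_periodic_net[OF assms(3)])
  moreover have "mean_equicontinuous M T f \<Longrightarrow> bounded_complexity M T f"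
    using mean_equicontinuous_imp_bounded_complexity assms(3) by (simp add: sq_integrable_def)
  ultimately show ?thesis
    using bounded_complexity_imp_almost_periodic[OF assms(3)] by blast
qed

end
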